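(* Let $n\ge1$ and let $\bm{N}=(N_0,N_1,\ldots,N_n)\in\mathbb{Z}^{n+1}$ be such that $\mathcal{F}_n(\bm{N})$ is non-empty, and let $s_k=\sum_{j=0}^k N_j$ for all $k$. Then \[ \sup_{\bm{f}\in\mathcal{F}_n(\bm{N})} e^{\mathcal{H}(\bm{f})} \;\geq\; K_n(\bm{N}) \;\geq\; \frac{\max_{0\le k\le n-1}\{e^{h(s_k)}\}}{\left(\prod_{k=0}^{n-1} e^{h(s_k)}\right)^2}\,\sup_{\bm{f}\in\mathcal{F}_n(\bm{N})} e^{\mathcal{H}(\bm{f})}. \]
   Context: $\mathcal{F}_n(\bm{N})$ is the set of $\bm{f}=(f_{ij})_{0\le i<j\le n}\in\mathbb{R}_{\ge0}^{\binom{n+1}{2}}$ with $\sum_{j>i} f_{ij}-\sum_{k<i} f_{ki}=N_i$ for every $i\in\{0,\ldots,n\}$ (flows on the complete directed graph on $\{0,\ldots,n\}$, edges $i\to j$ for $i<j$, with netflow $\bm{N}$), and $K_n(\bm{N})$ is its number of integer points. Let $h(t):=(t+1)\log(t+1)-t\log t$ for $t\ge0$ (with $0\log 0=0$). The flow entropy of $\bm{f}\in\mathcal{F}_n(\bm{N})$ is \[ \mathcal{H}(\bm{f}):=\sum_{0\le i<j\le n} h(f_{ij})+\sum_{0<j<n} h\Big(\sum_{0\le i<j}(N_i-f_{ij})\Big). \] *)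

theory Defs
  imports Complex_Main
begin

text \<open>A flow on the complete DAG on vertices 0..n is a function f :: nat => nat => real;
 f i j is the flow on the edge i -> j (i < j <= n). Values outside the edge set are
 required to be 0, so that a flow is exactly a vector in R^(binom (n+1) 2).\<close>

definition flows :: "nat \<Rightarrow> (nat \<Rightarrow> int) \<Rightarrow> (nat \<Rightarrow> nat \<Rightarrow> real) set" where
  "flows n N = {f. (\<forall>i j. \<not> (i < j \<and> j \<le> n) \<longrightarrow> f i j = 0)
                 \<and> (\<forall>i j. i < j \<and> j \<le> n \<longrightarrow> f i j \<ge> 0)
                 \<and> (\<forall>i\<le>n. (\<Sum>j\<in>{i<..n}. f i j) - (\<Sum>k<i. f k i) = real_of_int (N i))}"

definition Kn :: "nat \<Rightarrow> (nat \<Rightarrow> int) \<Rightarrow> nat" where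
  "Kn n N = card {f \<in> flows n N. \<forall>i j. f i j \<in> \<int>}"

definition hfun :: "real \<Rightarrow> real" where
  "hfun t = (t + 1) * ln (t + 1) - (if t = 0 then 0 else t * ln t)"

definition flow_entropy :: "nat \<Rightarrow> (nat \<Rightarrow> int) \<Rightarrow> (nat \<Rightarrow> nat \<Rightarrow> real) \<Rightarrow> real" where
  "flow_entropy n N f =
     (\<Sum>j\<in>{1..n}. \<Sum>i<j. hfun (f i j))
     + (\<Sum>j\<in>{0<..<n}. hfun (\<Sum>i<j. (real_of_int (N i) - f i j)))"

end

theory Submission
  imports Defs "HOL-Library.FuncSet"
begin

text \<open>
  Adding to a flow the amounts \<open>\<Sum>i<j. (N i - f i j)\<close> that pass over each inner vertex \<open>j\<close> turns flows
  into contingency tables with both margins \<open>s\<^sub>0, \<dots>, s\<^bsub>n-1\<^esub>\<close>, and the flow entropy into the sum of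
  \<open>h\<close> over all cells. The upper bound compares the uniform distribution on integer tables with
  independent geometric entries of the same means.

  For the lower bound, the generating function of tables, \<open>\<Prod> 1 / (1 - x\<^sub>i y\<^sub>j)\<close>, is at least
  \<open>exp H(M)\<close> times the monomial given by the margins of any real table \<open>M\<close>. Extracting one coefficient
  \<open>c\<^sub>b\<close> from a log-concave sequence \<open>c\<close> costs at most a factor \<open>exp (- h b)\<close>, because \<open>c\<close> has a geometric
  majorant touching it at \<open>b\<close>. The variables are eliminated in this way one at a time, the last
  one for free by homogeneity. Log-concavity holds because the second-order matrices
  \<open>c(\<beta> + e\<^sub>i + e\<^sub>j)\<close> have at most one positive eigenvalue, a property which is preserved by the
  partial sums along root directions that build the table count cell by cell.
\<close>

section \<open>Lorentzian forms\<close>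

text \<open>\<open>hfun m\<close> is the entropy of the geometric law with mean \<open>m\<close>,
  and \<open>exp (- hfun b)\<close> is the supremum of \<open>(1 - z) * z ^ b\<close> over
  \<open>0 < z < 1\<close>; both bounds rest on this double role. Rows and columns need different
  tools. Before any column is fixed the rows are independent, and each contributes a complete
  homogeneous symmetric polynomial, whose log-concavity is elementary. Once all row margins are
  fixed the columns are coupled and no product structure is left; this is where Lorentzian forms
  enter. They give log-concavity along \<open>e_j - e_j0\<close>, so while column \<open>j\<close>
  is eliminated the other open columns are merged into one reservoir \<open>j0\<close>. The factor
  in the theorem arises as follows: each \<open>s k\<close> is the margin of one row and of one
  column, hence the square; the column that costs nothing can be chosen, and the choice with largest
  \<open>hfun (s k)\<close> gives the maximum in the numerator.\<close>

definition comb :: "('i \<Rightarrow> real) \<Rightarrow> real \<Rightarrow> ('i \<Rightarrow> real) \<Rightarrow> 'i \<Rightarrow> real" where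
  "comb x r y = (\<lambda>i. x i + r * y i)"

definition sym_bilinear :: "(('i \<Rightarrow> real) \<Rightarrow> ('i \<Rightarrow> real) \<Rightarrow> real) \<Rightarrow> bool" where
  "sym_bilinear Q \<longleftrightarrow> (\<forall>x y. Q x y = Q y x)
     \<and> (\<forall>x y z r. Q (comb x r y) z = Q x z + r * Q y z)"

definition lin_functional :: "(('i \<Rightarrow> real) \<Rightarrow> real) \<Rightarrow> bool" where
  "lin_functional \<phi> \<longleftrightarrow> (\<forall>x y r. \<phi> (comb x r y) = \<phi> x + r * \<phi> y)"

text \<open>A form is called Lorentzian if it is negative semidefinite on some hyperplane, i.e. if it has
  at most one positive eigenvalue; this formulation avoids any choice of basis.\<close>

definition lorentzian :: "(('i \<Rightarrow> real) \<Rightarrow> ('i \<Rightarrow> real) \<Rightarrow> real) \<Rightarrow> bool" where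
  "lorentzian Q \<longleftrightarrow> (\<exists>\<phi>. lin_functional \<phi> \<and> (\<forall>x. \<phi> x = 0 \<longrightarrow> Q x x \<le> 0))"

lemma
  assumes "sym_bilinear Q"
  shows sym_bilinear_sym: "Q x y = Q y x"
    and sym_bilinear_left: "Q (comb x r y) z = Q x z + r * Q y z"
    and sym_bilinear_right: "Q z (comb x r y) = Q z x + r * Q z y"
proof -
  show s: "Q x y = Q y x" for x y using assms unfolding sym_bilinear_def by blast
  show l: "Q (comb x r y) z = Q x z + r * Q y z" for x y z r
    using assms unfolding sym_bilinear_def by blast
  show "Q z (comb x r y) = Q z x + r * Q z y"
    by (simp only: s[of z "comb x r y"] l s[of z x] s[of z y])
qed

lemma lin_functionalD:
  "lin_functional \<phi> \<Longrightarrow> \<phi> (comb x r y) = \<phi> x + r * \<phi> y"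
  unfolding lin_functional_def by simp

lemma lin_functional_right: "sym_bilinear Q \<Longrightarrow> lin_functional (Q p)"
  unfolding lin_functional_def by (simp add: sym_bilinear_right)

lemma sym_bilinear_expand:
  assumes "sym_bilinear Q"
  shows "Q (comb x r y) (comb x r y) = Q x x + 2 * r * Q x y + r\<^sup>2 * Q y y"
  unfolding sym_bilinear_left[OF assms] sym_bilinear_right[OF assms]
  using sym_bilinear_sym[OF assms, of y x] by (simp add: algebra_simps power2_eq_square)

text \<open>The functional witnessing \<open>lorentzian Q\<close> cannot vanish at \<open>p\<close>.
  Shifting \<open>x\<close> along \<open>p\<close> into its kernel gives the value
  \<open>Q x x + r\<^sup>2 * Q p p\<close>, since the cross term vanishes.\<close>

lemma lorentzian_orthogonal:
  assumes Q: "sym_bilinear Q" "lorentzian Q" and p: "Q p p > 0" and x: "Q p x = 0"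
  shows "Q x x \<le> 0"
proof -
  obtain \<phi> where \<phi>: "lin_functional \<phi>" "\<And>x. \<phi> x = 0 \<Longrightarrow> Q x x \<le> 0"
    using Q(2) unfolding lorentzian_def by blast
  have p0: "\<phi> p \<noteq> 0" using \<phi>(2)[of p] p by auto
  define r where "r = - \<phi> x / \<phi> p"
  have "\<phi> (comb x r p) = 0"
    unfolding lin_functionalD[OF \<phi>(1)] r_def using p0 by simp
  from \<phi>(2)[OF this] have "Q x x + 2 * r * Q x p + r\<^sup>2 * Q p p \<le> 0"
    unfolding sym_bilinear_expand[OF Q(1)] .
  moreover have "Q x p = 0" using x sym_bilinear_sym[OF Q(1), of x p] by simp
  moreover have "r\<^sup>2 * Q p p \<ge> 0" using p by simp
  ultimately show ?thesis by simp
qed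

text \<open>Apply \<open>lorentzian_orthogonal\<close> to the component of \<open>x\<close>
  orthogonal to \<open>p\<close>.\<close>

lemma lorentzian_reverse_Cauchy_Schwarz:
  assumes Q: "sym_bilinear Q" "lorentzian Q" and p: "Q p p > 0"
  shows "Q p p * Q x x \<le> (Q p x)\<^sup>2"
proof -
  define r where "r = - Q p x / Q p p"
  have s: "Q p x = Q x p" using sym_bilinear_sym[OF Q(1)] .
  have "Q p (comb x r p) = 0"
    unfolding sym_bilinear_right[OF Q(1)] r_def using p by simp
  from lorentzian_orthogonal[OF Q, OF p this]
  have "Q x x + 2 * r * Q x p + r\<^sup>2 * Q p p \<le> 0"
    unfolding sym_bilinear_expand[OF Q(1)] .
  then have "(Q x x + 2 * r * Q x p + r\<^sup>2 * Q p p) * Q p p \<le> 0"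
    using p by (simp add: mult_le_0_iff)
  moreover have "(Q x x + 2 * r * Q x p + r\<^sup>2 * Q p p) * Q p p = Q p p * Q x x - (Q p x)\<^sup>2"
    using p s unfolding r_def by (simp add: field_simps power2_eq_square)
  ultimately show ?thesis by simp
qed

text \<open>The limiting case of \<open>lorentzian_orthogonal\<close>. If \<open>Q x x > 0\<close>,
  the form is negative semidefinite on the complement of \<open>x\<close>; but this complement
  contains \<open>q\<close> and a vector pairing positively with \<open>q\<close>, so a small
  perturbation of \<open>q\<close> inside it has positive value.\<close>

lemma lorentzian_orthogonal_isotropic:
  assumes Q: "sym_bilinear Q" "lorentzian Q"
    and q: "Q q q = 0" and p: "Q q p > 0" and x: "Q q x = 0"
  shows "Q x x \<le> 0"
proof (rule ccontr)
  assume "\<not> Q x x \<le> 0"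
  then have xx: "Q x x > 0" by simp
  note sym = sym_bilinear_sym[OF Q(1)] and lin' = sym_bilinear_right[OF Q(1)]
  define p' where "p' = (comb p (- Q x p / Q x x) x)"
  have xp': "Q x p' = 0" unfolding p'_def lin' using xx by simp
  have qp': "Q q p' = Q q p" unfolding p'_def lin' using x by simp
  \<comment> \<open>Small enough for the linear term \<open>2 * d * Q q p\<close> to beat the
    quadratic term \<open>d\<^sup>2 * Q p' p'\<close>.\<close>
  define d where "d = Q q p / (1 + \<bar>Q p' p'\<bar>)"
  have d: "d > 0" using p unfolding d_def by (simp add: add_pos_nonneg)
  define y where "y = (comb q d p')"
  have "Q x y = 0" unfolding y_def lin' using xp' x sym[of x q] by simp
  then have "Q y y \<le> 0" using lorentzian_orthogonal[OF Q, OF xx] by simp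
  moreover have "Q y y = 2 * d * Q q p + d\<^sup>2 * Q p' p'"
    unfolding y_def sym_bilinear_expand[OF Q(1)] using q qp' by simp
  moreover have "d * \<bar>Q p' p'\<bar> \<le> Q q p"
    using p unfolding d_def by (simp add: field_simps)
  then have "d * (d * \<bar>Q p' p'\<bar>) \<le> d * Q q p"
    using d by (intro mult_left_mono) auto
  moreover have "d\<^sup>2 * Q p' p' \<ge> - (d * (d * \<bar>Q p' p'\<bar>))"
    using abs_ge_minus_self[of "d\<^sup>2 * Q p' p'"] d by (simp add: abs_mult power2_eq_square mult.assoc)
  moreover have "d * Q q p > 0" using d p by simp
  ultimately show False by linarith
qed

text \<open>If \<open>A p q \<ge> 0\<close>, both forms are negative semidefinite on the kernel of the common functional
  \<open>w = A p = B q\<close>. Otherwise \<open>B\<close> is negative on \<open>q\<close>; splitting off \<open>p\<close> from \<open>A\<close> and \<open>q\<close> from \<open>B\<close>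
  leaves a Lorentzian form plus \<open>w\<^sup>2 (1 / A p p - 1 / \<bar>A p q\<bar>)\<close>, whose coefficient is
  nonpositive by the last assumption.\<close>

lemma lorentzian_add:
  assumes A: "sym_bilinear A" "lorentzian A" and B: "sym_bilinear B" "lorentzian B"
    and link: "\<And>x. A p x = B q x" and pos: "A p p > 0" and sum: "A p p + A p q \<ge> 0"
  shows "lorentzian (\<lambda>x y. A x y + B x y)"
proof -
  note w = lin_functional_right[OF A(1), of p]
  show ?thesis
  proof (cases "A p q \<ge> 0")
    case True
    have "A x x + B x x \<le> 0" if x: "A p x = 0" for x
    proof -
      have "A x x \<le> 0" using lorentzian_orthogonal[OF A, OF pos x] .
      moreover have "B x x \<le> 0"
      \<comment> \<open>By \<open>link\<close>, \<open>B q q = A p q\<close> and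
        \<open>B q p = A p p > 0\<close>, so \<open>q\<close> is isotropic for \<open>B\<close> when
        \<open>A p q = 0\<close>.\<close>
      proof (cases "A p q = 0")
        case True
        show ?thesis
          by (rule lorentzian_orthogonal_isotropic[OF B, of q p]) (use True link[of q] link[of x] link[of p] x pos in auto)
      next
        case False
        then have "B q q > 0" using \<open>A p q \<ge> 0\<close> link[of q] by simp
        then show ?thesis using lorentzian_orthogonal[OF B, of q x] x link[of x] by simp
      qed
      ultimately show ?thesis by simp
    qed
    then show ?thesis unfolding lorentzian_def using w by blast
  next
    case False
    define c where "c = - A p q"
    have c: "c > 0" "c \<le> A p p" using False sum unfolding c_def by auto
    obtain \<phi> where \<phi>: "lin_functional \<phi>" "\<And>x. \<phi> x = 0 \<Longrightarrow> B x x \<le> 0"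
      using B(2) unfolding lorentzian_def by blast
    \<comment> \<open>\<open>\<psi> x\<close> is the value of \<open>\<phi>\<close> at
      \<open>x + (A p x / c) q\<close>, so this shift carries the kernel of \<open>\<psi>\<close>
      into that of \<open>\<phi>\<close>.\<close>
    define \<psi> where "\<psi> = (\<lambda>x. \<phi> x + A p x / c * \<phi> q)"
    have "lin_functional \<psi>"
      unfolding lin_functional_def \<psi>_def lin_functionalD[OF \<phi>(1)] lin_functionalD[OF w]
      by (simp add: algebra_simps add_divide_distrib)
    moreover have "A x x + B x x \<le> 0" if "\<psi> x = 0" for x
    proof -
      define r where "r = A p x / c"
      have "\<phi> (comb x r q) = 0"
        unfolding lin_functionalD[OF \<phi>(1)] r_def using that unfolding \<psi>_def .
      from \<phi>(2)[OF this] have "B x x + 2 * r * B x q + r\<^sup>2 * B q q \<le> 0"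
        unfolding sym_bilinear_expand[OF B(1)] .
      moreover have "B x q = A p x" using sym_bilinear_sym[OF B(1), of x q] link[of x] by simp
      moreover have "B q q = - c" using link[of q] unfolding c_def by simp
      moreover have "2 * r * A p x - r\<^sup>2 * c = (A p x)\<^sup>2 / c"
        using c unfolding r_def by (simp add: field_simps power2_eq_square)
      ultimately have "B x x + (A p x)\<^sup>2 / c \<le> 0" by simp
      moreover have "A x x \<le> (A p x)\<^sup>2 / A p p"
        using lorentzian_reverse_Cauchy_Schwarz[OF A, OF pos, of x] pos by (simp add: field_simps)
      moreover have "(A p x)\<^sup>2 / A p p \<le> (A p x)\<^sup>2 / c"
        using c pos by (intro divide_left_mono) auto
      ultimately show ?thesis by linarith
    qed
    ultimately show ?thesis unfolding lorentzian_def by blast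
  qed
qed

section \<open>Second-order matrices of coefficient arrays\<close>

definition bump :: "('i \<Rightarrow> int) \<Rightarrow> 'i \<Rightarrow> 'i \<Rightarrow> int" where
  "bump b i = (\<lambda>k. b k + of_bool (k = i))"

definition move :: "'i \<Rightarrow> 'i \<Rightarrow> ('i \<Rightarrow> int) \<Rightarrow> 'i \<Rightarrow> int" where
  "move u v b = (\<lambda>k. b k - of_bool (k = u) + of_bool (k = v))"

definition unit_vec :: "'i \<Rightarrow> 'i \<Rightarrow> real" where
  "unit_vec i = (\<lambda>k. of_bool (k = i))"

text \<open>For the exponential generating series with coefficients \<open>c\<close>, this is the
  Hessian form at the origin of its partial derivative of order \<open>\<beta>\<close>. Integer
  exponents spare any guard on \<open>move\<close>.\<close>

definition hess :: "'i set \<Rightarrow> (('i \<Rightarrow> int) \<Rightarrow> real) \<Rightarrow> ('i \<Rightarrow> int) \<Rightarrow> ('i \<Rightarrow> real) \<Rightarrow> ('i \<Rightarrow> real) \<Rightarrow> real" where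
  "hess I c \<beta> x y = (\<Sum>i\<in>I. \<Sum>j\<in>I. c (bump (bump \<beta> i) j) * x i * y j)"

lemma bump_commute: "bump (bump b i) j = bump (bump b j) i"
  by (auto simp: bump_def fun_eq_iff)

lemma bump_move: "bump (move u v b) i = move u v (bump b i)"
  by (auto simp: bump_def move_def fun_eq_iff)

lemma bump_move_source: "bump (move u v b) u = bump b v"
  by (auto simp: bump_def move_def fun_eq_iff)

lemma sym_bilinear_hess: "sym_bilinear (hess I c \<beta>)"
  unfolding sym_bilinear_def
proof (intro conjI allI)
  fix x y :: "'a \<Rightarrow> real"
  show "hess I c \<beta> x y = hess I c \<beta> y x"
    unfolding hess_def by (subst sum.swap) (simp add: bump_commute mult_ac)
next
  fix x y z :: "'a \<Rightarrow> real" and r :: real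
  show "hess I c \<beta> (comb x r y) z = hess I c \<beta> x z + r * hess I c \<beta> y z"
    unfolding hess_def comb_def by (simp add: algebra_simps sum.distrib sum_distrib_left)
qed

lemma hess_unit_vec_left:
  assumes "finite I" "i \<in> I"
  shows "hess I c \<beta> (unit_vec i) x = (\<Sum>j\<in>I. c (bump (bump \<beta> i) j) * x j)"
proof -
  have "hess I c \<beta> (unit_vec i) x =
      (\<Sum>k\<in>I. if k = i then \<Sum>j\<in>I. c (bump (bump \<beta> k) j) * x j else 0)"
    unfolding hess_def unit_vec_def by (intro sum.cong) auto
  then show ?thesis using assms by simp
qed

lemma hess_unit_vecs:
  assumes "finite I" "i \<in> I" "j \<in> I"
  shows "hess I c \<beta> (unit_vec i) (unit_vec j) = c (bump (bump \<beta> i) j)"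
proof -
  have "(\<Sum>k\<in>I. c (bump (bump \<beta> i) k) * unit_vec j k) =
      (\<Sum>k\<in>I. if k = j then c (bump (bump \<beta> i) k) else 0)"
    unfolding unit_vec_def by (intro sum.cong) auto
  then show ?thesis using assms by (simp add: hess_unit_vec_left)
qed

text \<open>The matrix is \<open>W\<close> times the rank-one matrix \<open>r i * r j\<close> minus
  a diagonal \<open>d i\<close>. Log-concavity of the factors says exactly that \<open>d\<close> is
  nonnegative, so the form is negative semidefinite where \<open>r\<close> pairs to zero.\<close>

lemma lorentzian_hess_product:
  fixes w :: "'i \<Rightarrow> int \<Rightarrow> real"
  assumes I: "finite I"
    and pos: "\<And>i k. i \<in> I \<Longrightarrow> k \<ge> 0 \<Longrightarrow> w i (\<beta> i + k) > 0"
    and lc: "\<And>i k. i \<in> I \<Longrightarrow> w i k * w i (k + 2) \<le> (w i (k + 1))\<^sup>2"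
  shows "lorentzian (hess I (\<lambda>b. \<Prod>i\<in>I. w i (b i)) \<beta>)"
proof -
  define W where "W = (\<Prod>i\<in>I. w i (\<beta> i))"
  define r where "r = (\<lambda>i. w i (\<beta> i + 1) / w i (\<beta> i))"
  define d where "d = (\<lambda>i. (r i)\<^sup>2 - w i (\<beta> i + 2) / w i (\<beta> i))"
  have pos0: "w i (\<beta> i) > 0" if "i \<in> I" for i using pos[of i 0] that by simp
  have W: "W > 0" unfolding W_def using pos0 by (intro prod_pos) auto
  have d: "d i \<ge> 0" if "i \<in> I" for i
    using lc[OF that, of "\<beta> i"] pos0[OF that] unfolding d_def r_def
    by (simp add: field_simps power2_eq_square)
  have entry: "(\<Prod>k\<in>I. w k (bump (bump \<beta> i) j k)) = W * (r i * r j - (if i = j then d i else 0))"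
    if ij: "i \<in> I" "j \<in> I" for i j
  proof (cases "i = j")
    case True
    have "(\<Prod>k\<in>I. w k (bump (bump \<beta> i) j k)) =
        (\<Prod>k\<in>I. w k (\<beta> k) * (if k = i then w i (\<beta> i + 2) / w i (\<beta> i) else 1))"
      using True pos0[OF ij(1)] by (intro prod.cong) (auto simp: bump_def add.commute)
    also have "\<dots> = W * (w i (\<beta> i + 2) / w i (\<beta> i))"
      using I ij by (simp add: prod.distrib W_def)
    finally show ?thesis using True by (simp add: d_def power2_eq_square)
  next
    case False
    have "(\<Prod>k\<in>I. w k (bump (bump \<beta> i) j k)) =
        (\<Prod>k\<in>I. w k (\<beta> k) * (if k = i then r i else 1) * (if k = j then r j else 1))"
      using False pos0[OF ij(1)] pos0[OF ij(2)]
      by (intro prod.cong) (auto simp: bump_def r_def)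
    also have "\<dots> = W * r i * r j"
      using I ij by (simp add: prod.distrib W_def)
    finally show ?thesis using False by simp
  qed
  define \<phi> where "\<phi> = (\<lambda>x. \<Sum>i\<in>I. r i * x i)"
  have "lin_functional \<phi>"
    unfolding lin_functional_def \<phi>_def comb_def
    by (simp add: algebra_simps sum.distrib sum_distrib_left)
  moreover have "hess I (\<lambda>b. \<Prod>i\<in>I. w i (b i)) \<beta> x x \<le> 0" if x: "\<phi> x = 0" for x
  proof -
    have "hess I (\<lambda>b. \<Prod>i\<in>I. w i (b i)) \<beta> x x =
        (\<Sum>i\<in>I. \<Sum>j\<in>I. W * (r i * x i * (r j * x j)) - (if i = j then W * d i * (x i)\<^sup>2 else 0))"
      unfolding hess_def
      by (intro sum.cong) (auto simp: entry algebra_simps power2_eq_square)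
    also have "\<dots> = (\<Sum>i\<in>I. \<Sum>j\<in>I. W * (r i * x i * (r j * x j))) - (\<Sum>i\<in>I. W * d i * (x i)\<^sup>2)"
      using I by (simp add: sum_subtractf)
    also have "(\<Sum>i\<in>I. \<Sum>j\<in>I. W * (r i * x i * (r j * x j))) = W * (\<phi> x * \<phi> x)"
      unfolding \<phi>_def sum_product by (simp add: sum_distrib_left)
    also have "W * (\<phi> x * \<phi> x) - (\<Sum>i\<in>I. W * d i * (x i)\<^sup>2) \<le> 0"
      using x W d by (simp add: sum_nonneg)
    finally show ?thesis .
  qed
  ultimately show ?thesis unfolding lorentzian_def by blast
qed

text \<open>Here \<open>c' b\<close> is the geometric partial sum of \<open>c\<close> along the root direction \<open>e\<^sub>u - e\<^sub>v\<close>. The forms of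
  \<open>c\<close> at \<open>\<beta>\<close> and of \<open>c'\<close> at \<open>\<beta> - e\<^sub>u + e\<^sub>v\<close> are linked through \<open>p = e\<^sub>v\<close> and
  \<open>q = e\<^sub>u / l - e\<^sub>v\<close>, as required by \<open>lorentzian_add\<close>.\<close>

lemma lorentzian_hess_partial_sum:
  fixes c c' :: "('i \<Rightarrow> int) \<Rightarrow> real"
  assumes I: "finite I" "Y \<subseteq> I" and u: "u \<in> Y" and v: "v \<in> I" "v \<notin> Y" and l: "l > 0"
    and rec: "\<And>b. c' b = c b + l * c' (move u v b)"
    and pos: "\<And>b. (\<forall>i\<in>Y. b i \<ge> 0) \<Longrightarrow> c b > 0"
    and zero: "\<And>b. b u < 0 \<Longrightarrow> c' b = 0"
    and lor: "\<And>\<beta>. (\<forall>i\<in>Y. \<beta> i \<ge> 0) \<Longrightarrow> lorentzian (hess I c \<beta>)"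
    and \<beta>: "\<forall>i\<in>Y. \<beta> i \<ge> 0"
  shows "lorentzian (hess I c' \<beta>)"
  using \<beta>
\<comment> \<open>Each use of \<open>rec\<close> takes one unit off the coordinate
  \<open>u\<close>.\<close>
proof (induction "nat (\<beta> u)" arbitrary: \<beta> rule: less_induct)
  case less
  have uI: "u \<in> I" and uv: "u \<noteq> v" using u v I by auto
  let ?\<gamma> = "move u v \<beta>"
  let ?A = "hess I c \<beta>" and ?B = "\<lambda>x y. l * hess I c' ?\<gamma> x y"
  define q where "q = (\<lambda>k. unit_vec u k / l - unit_vec v k)"
  have B: "sym_bilinear ?B"
    unfolding sym_bilinear_def
  proof (intro conjI allI)
    fix x y show "?B x y = ?B y x" by (simp only: sym_bilinear_sym[OF sym_bilinear_hess, of _ _ _ x y])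
  next
    fix x y z r show "?B (comb x r y) z = ?B x z + r * ?B y z"
      by (simp add: sym_bilinear_left[OF sym_bilinear_hess] algebra_simps)
  qed
  have lorB: "lorentzian ?B"
  proof (cases "\<beta> u = 0")
    \<comment> \<open>Now \<open>?\<gamma> u = -1\<close>, so by \<open>zero\<close> an entry
      survives only if one of its indices is \<open>u\<close>, and the form vanishes on
      \<open>x u = 0\<close>.\<close>
    case True
    have "?B x x = 0" if "x u = 0" for x
    proof -
      have *: "c' (bump (bump ?\<gamma> i) j) * x i * x j = 0" for i j
        using that True uv zero[of "bump (bump ?\<gamma> i) j"]
        by (cases "i = u"; cases "j = u") (auto simp: bump_def move_def)
      show ?thesis unfolding hess_def * by simp
    qed
    moreover have "lin_functional (\<lambda>x. x u)" by (simp add: lin_functional_def comb_def)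
    ultimately show ?thesis unfolding lorentzian_def by (metis order_refl)
  next
    case False
    have "lorentzian (hess I c' ?\<gamma>)"
    proof (rule less.hyps)
      show "\<forall>i\<in>Y. 0 \<le> ?\<gamma> i" using less.prems False u v by (auto simp: move_def)
      show "nat (?\<gamma> u) < nat (\<beta> u)" using less.prems False u uv by (force simp: move_def)
    qed
    then show ?thesis unfolding lorentzian_def using l by (auto simp: mult_le_0_iff)
  qed
  \<comment> \<open>The combination \<open>e_u / l - e_v\<close> telescopes the partial sum:
    \<open>rec\<close> at \<open>\<beta> + e_v + e_j\<close> turns row \<open>q\<close> of
    \<open>?B\<close> into row \<open>v\<close> of \<open>?A\<close>.\<close>
  have q: "?B q x = (\<Sum>j\<in>I. c (bump (bump \<beta> v) j) * x j)" for x
  proof -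
    have "q = comb (\<lambda>k. - unit_vec v k) (1 / l) (unit_vec u)"
      unfolding q_def comb_def by auto
    moreover have "(\<lambda>k. - unit_vec v k) = comb (\<lambda>_. 0) (- 1) (unit_vec v)"
      unfolding comb_def by auto
    moreover have "hess I c' ?\<gamma> (\<lambda>_. 0) x = 0" unfolding hess_def by simp
    ultimately have "?B q x = hess I c' ?\<gamma> (unit_vec u) x - l * hess I c' ?\<gamma> (unit_vec v) x"
      using l by (simp add: sym_bilinear_left[OF sym_bilinear_hess] algebra_simps)
    also have "\<dots> = (\<Sum>j\<in>I. (c' (bump (bump ?\<gamma> u) j) - l * c' (bump (bump ?\<gamma> v) j)) * x j)"
      using I uI v by (simp add: hess_unit_vec_left algebra_simps sum_subtractf sum_distrib_left)
    also have "\<dots> = (\<Sum>j\<in>I. c (bump (bump \<beta> v) j) * x j)"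
    proof (intro sum.cong refl)
      fix j assume "j \<in> I"
      show "(c' (bump (bump ?\<gamma> u) j) - l * c' (bump (bump ?\<gamma> v) j)) * x j
          = c (bump (bump \<beta> v) j) * x j"
        using rec[of "bump (bump \<beta> v) j"] by (simp add: bump_move_source bump_move)
    qed
    finally show ?thesis .
  qed
  have p: "?A (unit_vec v) x = ?B q x" for x
    using q I v by (simp add: hess_unit_vec_left)
  have nonneg: "\<forall>i\<in>Y. bump (bump \<beta> j) k i \<ge> 0" for j k
    using less.prems by (simp add: bump_def)
  have vv: "?A (unit_vec v) (unit_vec v) = c (bump (bump \<beta> v) v)"
    using I v by (simp add: hess_unit_vecs)
  have "q = comb (\<lambda>k. (1 / l) * unit_vec u k) (- 1) (unit_vec v)"
    unfolding q_def comb_def by auto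
  moreover have "(\<lambda>k. (1 / l) * unit_vec u k) = comb (\<lambda>_. 0) (1 / l) (unit_vec u)"
    unfolding comb_def by auto
  moreover have "?A (unit_vec v) (\<lambda>_. 0) = 0" unfolding hess_def by simp
  ultimately have "?A (unit_vec v) q = c (bump (bump \<beta> v) u) / l - c (bump (bump \<beta> v) v)"
    using I v uI by (simp add: sym_bilinear_right[OF sym_bilinear_hess] hess_unit_vecs)
  \<comment> \<open>The diagonal entry cancels, leaving
    \<open>c (\<beta> + e_v + e_u) / l\<close>.\<close>
  then have "?A (unit_vec v) (unit_vec v) + ?A (unit_vec v) q \<ge> 0"
    using vv pos[OF nonneg[of v u]] l by simp
  moreover have "?A (unit_vec v) (unit_vec v) > 0" using vv pos[OF nonneg[of v v]] by simp
  ultimately have "lorentzian (\<lambda>x y. ?A x y + ?B x y)"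
    using lorentzian_add[OF sym_bilinear_hess lor[OF less.prems] B lorB, OF p] by simp
  moreover have "(\<lambda>x y. ?A x y + ?B x y) = hess I c' \<beta>"
  proof (intro ext)
    fix x y
    have "hess I c' \<beta> x y = (\<Sum>i\<in>I. \<Sum>j\<in>I. (c (bump (bump \<beta> i) j)
        + l * c' (bump (bump ?\<gamma> i) j)) * x i * y j)"
      unfolding hess_def
    proof (intro sum.cong refl)
      fix i j
      show "c' (bump (bump \<beta> i) j) * x i * y j =
          (c (bump (bump \<beta> i) j) + l * c' (bump (bump ?\<gamma> i) j)) * x i * y j"
        using rec[of "bump (bump \<beta> i) j"] by (simp add: bump_move)
    qed
    also have "\<dots> = ?A x y + ?B x y"
      unfolding hess_def by (simp add: algebra_simps sum.distrib sum_distrib_left)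
    finally show "?A x y + ?B x y = hess I c' \<beta> x y" by simp
  qed
  ultimately show ?case by simp
qed

lemma lorentzian_hess_log_concave:
  assumes "finite I" "i \<in> I" "j \<in> I" "lorentzian (hess I c \<beta>)" "c (bump (bump \<beta> i) i) > 0"
  shows "c (bump (bump \<beta> i) i) * c (bump (bump \<beta> j) j) \<le> (c (bump (bump \<beta> i) j))\<^sup>2"
  using lorentzian_reverse_Cauchy_Schwarz[OF sym_bilinear_hess assms(4), of "unit_vec i" "unit_vec j"]
  using assms by (simp add: hess_unit_vecs)

section \<open>Weighted fillings of cells\<close>

text \<open>A cell \<open>c\<close> filled with multiplicity \<open>t c\<close> moves \<open>t c\<close> units from the coordinate \<open>dst c\<close> to the
  coordinate \<open>src c\<close>; what remains of \<open>b\<close> is weighted by \<open>w\<close>. With \<open>w\<close> the indicator of the prescribed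
  margins, \<open>filling_sum\<close> is a weighted count of contingency tables.\<close>

locale cell_system =
  fixes I Y :: "'i set" and cells :: "'c set" and dst src :: "'c \<Rightarrow> 'i" and wt :: "'c \<Rightarrow> real"
    and w :: "'i \<Rightarrow> int \<Rightarrow> real"
  assumes finite_I: "finite I" and Y_subset: "Y \<subseteq> I" and finite_cells: "finite cells"
    and dst: "\<And>c. c \<in> cells \<Longrightarrow> dst c \<in> Y"
    and src: "\<And>c. c \<in> cells \<Longrightarrow> src c \<in> I" "\<And>c. c \<in> cells \<Longrightarrow> src c \<notin> Y"
    and wt_pos: "\<And>c. c \<in> cells \<Longrightarrow> wt c > 0"
begin

definition residual :: "'c set \<Rightarrow> ('c \<Rightarrow> nat) \<Rightarrow> ('i \<Rightarrow> int) \<Rightarrow> 'i \<Rightarrow> int" where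
  "residual E t b = (\<lambda>i. b i - (\<Sum>c\<in>E. int (t c) * (of_bool (i = dst c) - of_bool (i = src c))))"

definition fillings :: "'c set \<Rightarrow> ('i \<Rightarrow> int) \<Rightarrow> ('c \<Rightarrow> nat) set" where
  "fillings E b = {t. (\<forall>c. c \<notin> E \<longrightarrow> t c = 0) \<and> (\<forall>i\<in>Y. residual E t b i \<ge> 0)}"

definition filling_sum :: "'c set \<Rightarrow> ('i \<Rightarrow> int) \<Rightarrow> real" where
  "filling_sum E b = (\<Sum>t\<in>fillings E b. (\<Prod>c\<in>E. wt c ^ t c) * (\<Prod>i\<in>I. w i (residual E t b i)))"

lemma residual_Y:
  assumes "E \<subseteq> cells" "i \<in> Y"
  shows "residual E t b i = b i - (\<Sum>c\<in>{c\<in>E. dst c = i}. int (t c))"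
proof -
  have E: "finite E" using assms finite_cells finite_subset by blast
  have "(\<Sum>c\<in>E. int (t c) * (of_bool (i = dst c) - of_bool (i = src c))) =
      (\<Sum>c\<in>E. if dst c = i then int (t c) else 0)"
    using assms src(2) by (intro sum.cong) auto
  then show ?thesis using E by (simp add: residual_def sum.inter_filter)
qed

lemma residual_not_Y:
  assumes "E \<subseteq> cells" "i \<notin> Y"
  shows "residual E t b i = b i + (\<Sum>c\<in>{c\<in>E. src c = i}. int (t c))"
proof -
  have E: "finite E" using assms finite_cells finite_subset by blast
  have "(\<Sum>c\<in>E. int (t c) * (of_bool (i = dst c) - of_bool (i = src c))) =
      (\<Sum>c\<in>E. - (if src c = i then int (t c) else 0))"
    using assms dst by (intro sum.cong) auto
  then show ?thesis using E by (simp add: residual_def sum.inter_filter sum_negf)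
qed

lemma finite_fillings:
  assumes E: "E \<subseteq> cells"
  shows "finite (fillings E b)"
proof -
  have fE: "finite E" using E finite_cells finite_subset by blast
  define B where "B = (\<Sum>i\<in>Y. nat (b i))"
  have fY: "finite Y" using finite_I Y_subset finite_subset by blast
  have "t c \<le> B" if t: "t \<in> fillings E b" and c: "c \<in> E" for t c
  proof -
    have dY: "dst c \<in> Y" using c E dst by blast
    have "int (t c) \<le> (\<Sum>c'\<in>{c'\<in>E. dst c' = dst c}. int (t c'))"
      using fE c by (intro member_le_sum) auto
    also have "\<dots> \<le> b (dst c)"
      using t dY residual_Y[OF E dY, of t b] unfolding fillings_def by fastforce
    finally have "t c \<le> nat (b (dst c))" by simp
    also have "\<dots> \<le> B" unfolding B_def using fY dY by (intro member_le_sum) auto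
    finally show ?thesis .
  qed
  then have "fillings E b \<subseteq> {t. \<forall>c. (c \<in> E \<longrightarrow> t c \<in> {..B}) \<and> (c \<notin> E \<longrightarrow> t c = 0)}"
    unfolding fillings_def by auto
  then show ?thesis using finite_set_of_finite_funs[OF fE, of "{..B}"] finite_subset by blast
qed

lemma filling_sum_empty: "filling_sum {} b = (if \<forall>i\<in>Y. b i \<ge> 0 then \<Prod>i\<in>I. w i (b i) else 0)"
proof -
  have "fillings {} b = (if \<forall>i\<in>Y. b i \<ge> 0 then {\<lambda>_. 0} else {})"
    unfolding fillings_def residual_def by (auto simp: fun_eq_iff)
  then show ?thesis unfolding filling_sum_def by (simp add: residual_def)
qed

lemma fillings_neg:
  assumes "E \<subseteq> cells" "i \<in> Y" "b i < 0"
  shows "fillings E b = {}"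
proof -
  have "residual E t b i < 0" for t
    using assms sum_nonneg[of "{c\<in>E. dst c = i}" "\<lambda>c. int (t c)"] by (simp add: residual_Y)
  then show ?thesis unfolding fillings_def using assms(2) by (auto simp: not_le)
qed

lemma filling_sum_insert:
  assumes c: "c \<in> cells" "c \<notin> E" and E: "E \<subseteq> cells"
  shows "filling_sum (insert c E) b =
    filling_sum E b + wt c * filling_sum (insert c E) (move (dst c) (src c) b)"
proof -
  let ?E = "insert c E" and ?m = "move (dst c) (src c) b"
  let ?f = "\<lambda>E b t. (\<Prod>c\<in>E. wt c ^ t c) * (\<Prod>i\<in>I. w i (residual E t b i))"
  have fE: "finite E" using E finite_cells finite_subset by blast
  have cE: "?E \<subseteq> cells" using c E by blast
  let ?S0 = "{t \<in> fillings ?E b. t c = 0}" and ?S1 = "{t \<in> fillings ?E b. t c > 0}"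
  have fin: "finite (fillings ?E b)" using finite_fillings[OF cE] .
  have "filling_sum ?E b = sum (?f ?E b) (?S0 \<union> ?S1)"
    unfolding filling_sum_def by (intro sum.cong) auto
  also have "\<dots> = sum (?f ?E b) ?S0 + sum (?f ?E b) ?S1"
    using fin by (intro sum.union_disjoint) auto
  also have "sum (?f ?E b) ?S0 = filling_sum E b"
  proof -
    have r: "residual ?E t b = residual E t b" if "t c = 0" for t
      unfolding residual_def using fE c that by simp
    have "?S0 = fillings E b"
    proof (intro set_eqI iffI)
      fix t assume "t \<in> ?S0"
      then have *: "t c = 0" "\<And>d. d \<noteq> c \<Longrightarrow> d \<notin> E \<Longrightarrow> t d = 0" "\<forall>i\<in>Y. residual E t b i \<ge> 0"
        using r[of t] unfolding fillings_def by auto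
      have "t d = 0" if "d \<notin> E" for d using *(1,2) that by (cases "d = c") auto
      then show "t \<in> fillings E b" using *(3) by (simp add: fillings_def)
    next
      fix t assume t: "t \<in> fillings E b"
      then have "t c = 0" using c unfolding fillings_def by auto
      then show "t \<in> ?S0" using t r[of t] unfolding fillings_def by auto
    qed
    moreover have "?f ?E b t = ?f E b t" if "t \<in> ?S0" for t
      using that r[of t] fE c by simp
    ultimately show ?thesis unfolding filling_sum_def by (intro sum.cong) auto
  qed
  also have "sum (?f ?E b) ?S1 = (\<Sum>t\<in>fillings ?E ?m. wt c * ?f ?E ?m t)"
  proof -
    have r: "residual ?E (t(c := Suc (t c))) b = residual ?E t ?m" for t
    proof -
      have "(\<Sum>d\<in>E. int ((t(c := Suc (t c))) d) * (of_bool (i = dst d) - of_bool (i = src d))) =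
          (\<Sum>d\<in>E. int (t d) * (of_bool (i = dst d) - of_bool (i = src d)))" for i
        using c by (intro sum.cong) auto
      then show ?thesis
        unfolding residual_def move_def using fE c by (auto simp: algebra_simps fun_eq_iff)
    qed
    show ?thesis
    proof (rule sum.reindex_bij_witness[where i = "\<lambda>t. t(c := Suc (t c))" and j = "\<lambda>t. t(c := t c - 1)"])
      fix t assume t: "t \<in> ?S1"
      then show eq: "(t(c := t c - 1))(c := Suc ((t(c := t c - 1)) c)) = t" by auto
      have r': "residual ?E (t(c := t c - 1)) ?m = residual ?E t b"
        using r[of "t(c := t c - 1)"] eq by simp
      show "t(c := t c - 1) \<in> fillings ?E ?m"
        using t r' unfolding fillings_def by auto
      have "(\<Prod>d\<in>E. wt d ^ (t(c := t c - 1)) d) = (\<Prod>d\<in>E. wt d ^ t d)"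
        using c by (intro prod.cong) auto
      moreover have "wt c ^ t c = wt c * wt c ^ (t c - 1)" using t by (simp add: power_eq_if)
      ultimately show "wt c * ?f ?E ?m (t(c := t c - 1)) = ?f ?E b t"
        using r' fE c by (simp add: mult_ac)
    next
      fix t assume t: "t \<in> fillings ?E ?m"
      then show "t(c := Suc (t c)) \<in> ?S1" using r[of t] unfolding fillings_def by auto
    qed auto
  qed
  also have "\<dots> = wt c * filling_sum ?E ?m"
    unfolding filling_sum_def by (simp add: sum_distrib_left)
  finally show ?thesis .
qed

end

text \<open>\<open>w_neg\<close> lets the weights encode the constraint on \<open>Y\<close>, so the
  array without cells is a pure product. Strict positivity supplies \<open>A p p > 0\<close> in
  \<open>lorentzian_add\<close> for each added cell.\<close>

locale log_concave_cell_system = cell_system +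
  assumes w_pos: "\<And>i k. i \<in> I \<Longrightarrow> (i \<in> Y \<Longrightarrow> k \<ge> 0) \<Longrightarrow> w i k > 0"
    and w_neg: "\<And>i k. i \<in> Y \<Longrightarrow> k < 0 \<Longrightarrow> w i k = 0"
    and w_log_concave: "\<And>i k. i \<in> I \<Longrightarrow> w i k * w i (k + 2) \<le> (w i (k + 1))\<^sup>2"
begin

lemma filling_sum_pos:
  assumes "E \<subseteq> cells" "\<forall>i\<in>Y. b i \<ge> 0"
  shows "filling_sum E b > 0"
proof -
  have "finite E" using assms finite_cells finite_subset by blast
  have pos: "(\<Prod>c\<in>E. wt c ^ t c) * (\<Prod>i\<in>I. w i (residual E t b i)) > 0" if "t \<in> fillings E b" for t
    using that assms wt_pos w_pos unfolding fillings_def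
    by (intro mult_pos_pos prod_pos zero_less_power) auto
  have "(\<lambda>_. 0) \<in> fillings E b" using assms unfolding fillings_def residual_def by simp
  then show ?thesis unfolding filling_sum_def
    using pos finite_fillings[OF assms(1)] by (intro sum_pos) auto
qed

lemma lorentzian_filling_sum:
  assumes "E \<subseteq> cells" "\<forall>i\<in>Y. \<beta> i \<ge> 0"
  shows "lorentzian (hess I (filling_sum E) \<beta>)"
proof -
  have "finite E" using assms finite_cells finite_subset by blast
  then show ?thesis using assms
  proof (induction E arbitrary: \<beta>)
    case empty
    have "filling_sum {} = (\<lambda>b. \<Prod>i\<in>I. w i (b i))"
    proof
      fix b
      show "filling_sum {} b = (\<Prod>i\<in>I. w i (b i))"
      proof (cases "\<forall>i\<in>Y. b i \<ge> 0")
        case False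
        then obtain i where "i \<in> Y" "b i < 0" by force
        then have "(\<Prod>i\<in>I. w i (b i)) = 0"
          using w_neg finite_I Y_subset by (intro prod_zero) auto
        then show ?thesis using False by (auto simp: filling_sum_empty)
      qed (simp add: filling_sum_empty)
    qed
    moreover have "lorentzian (hess I (\<lambda>b. \<Prod>i\<in>I. w i (b i)) \<beta>)"
      using empty finite_I w_pos w_log_concave by (intro lorentzian_hess_product) auto
    ultimately show ?case by simp
  next
    case (insert c E)
    have c: "c \<in> cells" and E: "E \<subseteq> cells" using insert.prems by auto
    show ?case
    proof (rule lorentzian_hess_partial_sum[OF finite_I Y_subset dst[OF c] src[OF c] wt_pos[OF c]])
      show "filling_sum (insert c E) b =
          filling_sum E b + wt c * filling_sum (insert c E) (move (dst c) (src c) b)" for b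
        by (rule filling_sum_insert[OF c insert.hyps(2) E])
      show "filling_sum E b > 0" if "\<forall>i\<in>Y. b i \<ge> 0" for b
        using filling_sum_pos[OF E that] .
      show "filling_sum (insert c E) b = 0" if "b (dst c) < 0" for b
        using fillings_neg[where b = b, OF insert.prems(1) dst[OF c] that] unfolding filling_sum_def by simp
      show "lorentzian (hess I (filling_sum E) \<beta>)" if "\<forall>i\<in>Y. \<beta> i \<ge> 0" for \<beta>
        using insert.IH[OF E that] .
    qed (rule insert.prems)
  qed
qed

lemma filling_sum_log_concave:
  assumes "\<forall>k\<in>Y. \<beta> k \<ge> 0" "i \<in> I" "j \<in> I"
  shows "filling_sum cells (bump (bump \<beta> i) i) * filling_sum cells (bump (bump \<beta> j) j)
    \<le> (filling_sum cells (bump (bump \<beta> i) j))\<^sup>2"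
  by (rule lorentzian_hess_log_concave[OF finite_I assms(2,3)
        lorentzian_filling_sum[OF order_refl assms(1)]])
    (rule filling_sum_pos, use assms in \<open>auto simp: bump_def\<close>)

end

section \<open>Coefficients of log-concave sequences\<close>

text \<open>The right side is the cross entropy of the geometric law with parameter \<open>z\<close>
  against one of mean \<open>m\<close>. Two uses of \<open>ln x \<le> x - 1\<close>, with weights
  \<open>1\<close> and \<open>m\<close>, are both tight at \<open>z = m / (m + 1)\<close>.\<close>

lemma hfun_le:
  assumes "m \<ge> 0" "0 < z" "z < 1"
  shows "hfun m \<le> - ln (1 - z) - m * ln z"
proof (cases "m = 0")
  case True
  then show ?thesis using assms ln_le_zero_iff[of "1 - z"] by (simp add: hfun_def)
next
  case False
  then have m: "m > 0" using assms by simp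
  have "ln ((1 - z) * (m + 1)) \<le> (1 - z) * (m + 1) - 1"
    using m assms by (intro ln_le_minus_one) simp
  moreover have "ln (z * (m + 1) / m) \<le> z * (m + 1) / m - 1"
    using m assms by (intro ln_le_minus_one) simp
  then have "m * ln (z * (m + 1) / m) \<le> m * (z * (m + 1) / m - 1)"
    using m by (intro mult_left_mono) auto
  moreover have "m * (z * (m + 1) / m - 1) = z * (m + 1) - m" using m by (simp add: field_simps)
  moreover have "ln ((1 - z) * (m + 1)) = ln (1 - z) + ln (m + 1)"
    using m assms by (simp add: ln_mult)
  moreover have "ln (z * (m + 1) / m) = ln z + ln (m + 1) - ln m"
    using m assms by (simp add: ln_mult ln_div)
  ultimately have "ln (1 - z) + ln (m + 1) + m * (ln z + ln (m + 1) - ln m)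
      \<le> (1 - z) * (m + 1) - 1 + (z * (m + 1) - m)" by simp
  then show ?thesis using m by (simp add: hfun_def algebra_simps)
qed

lemma exp_neg_hfun_nat:
  assumes "b > 0" and z_def: "z = real b / (real b + 1)"
  shows "(1 - z) * z ^ b = exp (- hfun (real b))"
proof -
  have z: "0 < z" "z < 1" using assms by auto
  have "1 - z = 1 / (real b + 1)" unfolding z_def by (simp add: field_simps)
  then have "ln (1 - z) = - ln (real b + 1)" by (simp add: ln_div)
  moreover have "ln z = ln (real b) - ln (real b + 1)" unfolding z_def using assms by (simp add: ln_div)
  moreover have "real b * ln z = real b * (ln (real b) - ln (real b + 1))"
    using calculation(2) by (rule arg_cong)
  ultimately have "- hfun (real b) = ln (1 - z) + real b * ln z"
    using assms(1) by (simp add: hfun_def algebra_simps)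
  then show ?thesis using z by (simp add: exp_add exp_of_nat_mult)
qed

text \<open>The best \<open>z\<close> is \<open>b / (b + 1)\<close>; for \<open>b = 0\<close> it
  falls on the excluded endpoint, so a limit replaces it.\<close>

lemma hfun_bound_of_all:
  assumes "\<And>z. 0 < z \<Longrightarrow> z < 1 \<Longrightarrow> (1 - z) * z ^ b * R \<le> c"
  shows "exp (- hfun (real b)) * R \<le> c"
proof (cases "b = 0")
  case True
  have "R \<le> c"
  proof (rule field_le_mult_one_interval)
    fix z :: real assume "0 < z" "z < 1"
    then show "z * R \<le> c" using assms[of "1 - z"] True by simp
  qed
  then show ?thesis using True by (simp add: hfun_def)
next
  case False
  then show ?thesis
    using assms[of "real b / (real b + 1)"] exp_neg_hfun_nat[of b] by simp
qed

text \<open>The slope \<open>r\<close> only has to separate the ratios before \<open>b\<close> from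
  those after it. Powers on both sides avoid negative exponents.\<close>

lemma geometric_majorant:
  fixes c :: "nat \<Rightarrow> real"
  assumes r: "r > 0"
    and up: "\<And>m. b \<le> m \<Longrightarrow> m < D \<Longrightarrow> c (Suc m) \<le> r * c m"
    and down: "\<And>m. m < b \<Longrightarrow> r * c m \<le> c (Suc m)"
    and k: "k \<le> D"
  shows "c k * r ^ b \<le> c b * r ^ k"
proof (cases "b \<le> k")
  case True
  then show ?thesis using k
  proof (induction k rule: dec_induct)
    case (step n)
    then have "c (Suc n) * r ^ b \<le> (r * c n) * r ^ b"
      using up[of n] r by (intro mult_right_mono) auto
    moreover have "r * (c n * r ^ b) \<le> r * (c b * r ^ n)"
      using step r by (intro mult_left_mono) auto
    ultimately show ?case by (simp add: mult_ac)
  qed simp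
next
  case False
  then have "k \<le> b" by simp
  then show ?thesis
  proof (induction k rule: inc_induct)
    case (step n)
    have "r * (c n * r ^ b) \<le> c (Suc n) * r ^ b"
      using down[of n] step r by (simp add: mult_ac)
    also have "\<dots> \<le> c b * r ^ Suc n" using step by simp
    also have "\<dots> = r * (c b * r ^ n)" by simp
    finally show ?case using r by simp
  qed simp
qed

lemma log_concave_ratio_antimono:
  fixes c :: "nat \<Rightarrow> real"
  assumes pos: "\<And>k. k \<le> D \<Longrightarrow> c k > 0"
    and lc: "\<And>k. k + 2 \<le> D \<Longrightarrow> c k * c (k + 2) \<le> (c (k + 1))\<^sup>2"
    and "m \<le> n" "n < D"
  shows "c (Suc n) / c n \<le> c (Suc m) / c m"
  using \<open>m \<le> n\<close> \<open>n < D\<close>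
proof (induction n rule: dec_induct)
  case (step n)
  have "c (Suc (Suc n)) / c (Suc n) \<le> c (Suc n) / c n"
    using lc[of n] pos[of n] pos[of "Suc n"] step by (simp add: field_simps power2_eq_square)
  then show ?case using step by simp
qed simp

lemma log_concave_geometric_majorant:
  fixes c :: "nat \<Rightarrow> real"
  assumes pos: "\<And>k. k \<le> D \<Longrightarrow> c k > 0"
    and lc: "\<And>k. k + 2 \<le> D \<Longrightarrow> c k * c (k + 2) \<le> (c (k + 1))\<^sup>2"
    and b: "b \<le> D"
  obtains r where "r > 0" "\<And>k. k \<le> D \<Longrightarrow> c k * r ^ b \<le> c b * r ^ k"
proof -
  \<comment> \<open>The ratio just after \<open>b\<close>, or the last one available if
    \<open>b = D\<close>; for \<open>D = 0\<close> there is no ratio and any slope works.\<close>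
  define m where "m = (if b < D then b else b - 1)"
  define r where "r = (if D = 0 then 1 else c (Suc m) / c m)"
  have "r > 0" using pos b unfolding r_def m_def by simp
  moreover have "c k * r ^ b \<le> c b * r ^ k" if "k \<le> D" for k
  proof (rule geometric_majorant[OF \<open>r > 0\<close> _ _ that])
    fix n assume n: "b \<le> n" "n < D"
    then have "c (Suc n) / c n \<le> r"
      unfolding r_def m_def using log_concave_ratio_antimono[OF pos lc, of D b n] by simp
    then show "c (Suc n) \<le> r * c n" using pos[of n] n by (simp add: field_simps)
  next
    fix n assume n: "n < b"
    then have "r \<le> c (Suc n) / c n"
      unfolding r_def m_def using b log_concave_ratio_antimono[OF pos lc, of D n "if b < D then b else b - 1"]
      by (auto split: if_splits)
    then show "r * c n \<le> c (Suc n)" using pos[of n] n b by (simp add: field_simps)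
  qed
  ultimately show ?thesis using that by blast
qed

text \<open>Put \<open>y = z / r\<close> with \<open>r\<close> the slope of the majorant at
  \<open>b\<close>: the sum is then at most \<open>c b\<close> times a geometric series in
  \<open>z\<close>, which gives \<open>(1 - z) * z ^ b * R \<le> c b\<close>.\<close>

lemma log_concave_coefficient_bound:
  fixes c :: "nat \<Rightarrow> real"
  assumes pos: "\<And>k. k \<le> D \<Longrightarrow> c k > 0"
    and lc: "\<And>k. k + 2 \<le> D \<Longrightarrow> c k * c (k + 2) \<le> (c (k + 1))\<^sup>2"
    and b: "b \<le> D"
    and R: "\<And>y. y > 0 \<Longrightarrow> R * y ^ b \<le> (\<Sum>k\<le>D. c k * y ^ k)"
  shows "exp (- hfun (real b)) * R \<le> c b"
proof (rule hfun_bound_of_all)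
  fix z :: real assume z: "0 < z" "z < 1"
  obtain r where r: "r > 0" "\<And>k. k \<le> D \<Longrightarrow> c k * r ^ b \<le> c b * r ^ k"
    using log_concave_geometric_majorant[OF pos lc b] by blast
  have "R * z ^ b = R * (z / r) ^ b * r ^ b" using r by (simp add: power_divide)
  also have "\<dots> \<le> (\<Sum>k\<le>D. c k * (z / r) ^ k) * r ^ b"
    using R[of "z / r"] r z by (intro mult_right_mono) auto
  also have "\<dots> = (\<Sum>k\<le>D. (c k * r ^ b) * (z / r) ^ k)"
    unfolding sum_distrib_right by (intro sum.cong) auto
  also have "\<dots> \<le> (\<Sum>k\<le>D. (c b * r ^ k) * (z / r) ^ k)"
    using r z by (intro sum_mono mult_right_mono) auto
  also have "\<dots> = c b * (\<Sum>k\<le>D. z ^ k)"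
    using r by (simp add: sum_distrib_left power_divide)
  finally have "(1 - z) * (R * z ^ b) \<le> (1 - z) * (c b * (\<Sum>k\<le>D. z ^ k))"
    using z by (intro mult_left_mono) auto
  also have "\<dots> = c b * ((1 - z) * (\<Sum>k<Suc D. z ^ k))" by (simp add: lessThan_Suc_atMost)
  also have "\<dots> = c b * (1 - z ^ Suc D)" by (simp only: one_diff_power_eq)
  also have "\<dots> \<le> c b" using pos[OF b] z by (simp add: algebra_simps)
  finally show "(1 - z) * z ^ b * R \<le> c b" by (simp add: mult_ac)
qed

section \<open>Contingency tables\<close>

definition tables :: "('r \<times> 'k) set \<Rightarrow> ('r \<Rightarrow> nat) \<Rightarrow> ('k \<Rightarrow> nat) \<Rightarrow> 'k set \<Rightarrow> ('r \<times> 'k \<Rightarrow> nat) set" where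
  "tables E a b F = {t. (\<forall>c. c \<notin> E \<longrightarrow> t c = 0)
     \<and> (\<forall>i\<in>fst ` E. (\<Sum>c\<in>{c\<in>E. fst c = i}. t c) = a i)
     \<and> (\<forall>j\<in>F. (\<Sum>c\<in>{c\<in>E. snd c = j}. t c) = b j)}"

text \<open>In the product of \<open>1 / (1 - x i * y j)\<close> over the cells, this is the
  coefficient of all \<open>x i ^ a i\<close> and of \<open>y j ^ b j\<close> for \<open>j\<close>
  in \<open>F\<close>, as a polynomial in the other column variables.\<close>

definition column_sum :: "('r \<times> 'k) set \<Rightarrow> ('r \<Rightarrow> nat) \<Rightarrow> ('k \<Rightarrow> nat) \<Rightarrow> 'k set \<Rightarrow> ('k \<Rightarrow> real) \<Rightarrow> real" where
  "column_sum E a b F y = (\<Sum>t\<in>tables E a b F. \<Prod>c\<in>{c\<in>E. snd c \<notin> F}. y (snd c) ^ t c)"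

lemma finite_tables:
  assumes "finite E"
  shows "finite (tables E a b F)"
proof -
  define B where "B = (\<Sum>i\<in>fst ` E. a i)"
  have "t c \<le> B" if t: "t \<in> tables E a b F" and c: "c \<in> E" for t c
  proof -
    have "t c \<le> (\<Sum>c'\<in>{c'\<in>E. fst c' = fst c}. t c')"
      using assms c by (intro member_le_sum) auto
    also have "\<dots> = a (fst c)" using t c unfolding tables_def by auto
    also have "\<dots> \<le> B" unfolding B_def using assms c by (intro member_le_sum) auto
    finally show ?thesis .
  qed
  then have "tables E a b F \<subseteq> {t. \<forall>c. (c \<in> E \<longrightarrow> t c \<in> {..B}) \<and> (c \<notin> E \<longrightarrow> t c = 0)}"
    unfolding tables_def by auto
  then show ?thesis using finite_set_of_finite_funs[OF assms, of "{..B}"] finite_subset by blast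
qed

lemma sum_by_rows:
  fixes t :: "'r \<times> 'k \<Rightarrow> 'm::comm_monoid_add"
  assumes "finite E"
  shows "(\<Sum>c\<in>E. t c) = (\<Sum>i\<in>fst ` E. \<Sum>c\<in>{c\<in>E. fst c = i}. t c)"
  using assms by (subst sum.group) auto

lemma sum_by_columns:
  fixes t :: "'r \<times> 'k \<Rightarrow> 'm::comm_monoid_add"
  assumes "finite E" "finite F"
  shows "(\<Sum>c\<in>E. t c) = (\<Sum>j\<in>F. \<Sum>c\<in>{c\<in>E. snd c = j}. t c) + (\<Sum>c\<in>{c\<in>E. snd c \<notin> F}. t c)"
proof -
  have "(\<Sum>c\<in>E. t c) = (\<Sum>c\<in>{c\<in>E. snd c \<in> F} \<union> {c\<in>E. snd c \<notin> F}. t c)"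
    by (intro sum.cong) auto
  also have "\<dots> = (\<Sum>c\<in>{c\<in>E. snd c \<in> F}. t c) + (\<Sum>c\<in>{c\<in>E. snd c \<notin> F}. t c)"
    using assms by (intro sum.union_disjoint) auto
  also have "(\<Sum>c\<in>{c\<in>E. snd c \<in> F}. t c) =
      (\<Sum>j\<in>F. \<Sum>c\<in>{c\<in>{c\<in>E. snd c \<in> F}. snd c = j}. t c)"
    using assms by (subst sum.group) auto
  also have "\<dots> = (\<Sum>j\<in>F. \<Sum>c\<in>{c\<in>E. snd c = j}. t c)"
    by (intro sum.cong) auto
  finally show ?thesis .
qed

lemma column_sum_split:
  assumes E: "finite E" and j: "j \<notin> F"
    and D: "\<And>t. t \<in> tables E a b F \<Longrightarrow> (\<Sum>c\<in>{c\<in>E. snd c = j}. t c) \<le> D"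
  shows "column_sum E a b F y = (\<Sum>k\<le>D. column_sum E a (b(j := k)) (insert j F) y * y j ^ k)"
proof -
  let ?col = "\<lambda>t. \<Sum>c\<in>{c\<in>E. snd c = j}. t c"
  let ?f = "\<lambda>t. \<Prod>c\<in>{c\<in>E. snd c \<notin> F}. y (snd c) ^ t c"
  have "column_sum E a b F y = (\<Sum>k\<le>D. \<Sum>t\<in>{t \<in> tables E a b F. ?col t = k}. ?f t)"
    unfolding column_sum_def using E D by (subst sum.group) (auto intro: finite_tables)
  also have "\<dots> = (\<Sum>k\<le>D. column_sum E a (b(j := k)) (insert j F) y * y j ^ k)"
  proof (rule sum.cong[OF refl])
    fix k
    have T: "{t \<in> tables E a b F. ?col t = k} = tables E a (b(j := k)) (insert j F)"
      unfolding tables_def using j by auto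
    have "?f t = (\<Prod>c\<in>{c\<in>E. snd c \<notin> insert j F}. y (snd c) ^ t c) * y j ^ k"
      if t: "?col t = k" for t
    proof -
      have "?f t = (\<Prod>c\<in>{c\<in>E. snd c \<notin> insert j F} \<union> {c\<in>E. snd c = j}. y (snd c) ^ t c)"
        using j by (intro prod.cong) auto
      also have "\<dots> = (\<Prod>c\<in>{c\<in>E. snd c \<notin> insert j F}. y (snd c) ^ t c)
          * (\<Prod>c\<in>{c\<in>E. snd c = j}. y (snd c) ^ t c)"
        using E by (intro prod.union_disjoint) auto
      also have "(\<Prod>c\<in>{c\<in>E. snd c = j}. y (snd c) ^ t c) = y j ^ k"
        unfolding t[symmetric] power_sum by (intro prod.cong) auto
      finally show ?thesis .
    qed
    then show "(\<Sum>t\<in>{t \<in> tables E a b F. ?col t = k}. ?f t) =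
        column_sum E a (b(j := k)) (insert j F) y * y j ^ k"
      unfolding column_sum_def T[symmetric] by (simp add: sum_distrib_right)
  qed
  finally show ?thesis .
qed

lemma log_concave_power_dist:
  fixes \<epsilon> :: real
  assumes "0 < \<epsilon>" "\<epsilon> < 1"
  shows "\<epsilon> ^ nat \<bar>k - a\<bar> * \<epsilon> ^ nat \<bar>k + 2 - a\<bar> \<le> (\<epsilon> ^ nat \<bar>k + 1 - a\<bar>)\<^sup>2"
proof -
  have "nat \<bar>k + 1 - a\<bar> * 2 \<le> nat \<bar>k - a\<bar> + nat \<bar>k + 2 - a\<bar>" by linarith
  then have "\<epsilon> ^ (nat \<bar>k - a\<bar> + nat \<bar>k + 2 - a\<bar>) \<le> \<epsilon> ^ (nat \<bar>k + 1 - a\<bar> * 2)"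
    using assms by (intro power_decreasing) auto
  then show ?thesis by (simp only: power_add power_mult)
qed

text \<open>The columns outside \<open>insert j F\<close> are merged into \<open>j0\<close>, their variables becoming cell weights.
  The margin indicators are replaced by powers of \<open>\<epsilon>\<close> so that all coefficients are strictly
  positive, as \<open>lorentzian_add\<close> demands; they are recovered from above as \<open>\<epsilon> \<rightarrow> 0\<close>.\<close>

lemma column_sum_log_concave_approx:
  fixes E :: "('r \<times> 'k) set"
  assumes E: "finite E" and F: "finite F" "j \<notin> F" "j0 \<notin> F" "j \<noteq> j0"
    and D: "(\<Sum>j\<in>F. b j) + D = (\<Sum>i\<in>fst ` E. a i)"
    and y: "\<And>j. y j > 0"
  obtains g :: "real \<Rightarrow> nat \<Rightarrow> real" where
    "\<And>k. k \<le> D \<Longrightarrow> ((\<lambda>\<epsilon>. g \<epsilon> k) \<longlongrightarrow> column_sum E a (b(j := k)) (insert j F) y) (at_right 0)"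
    "\<And>\<epsilon> k. 0 < \<epsilon> \<Longrightarrow> \<epsilon> < 1 \<Longrightarrow> k \<le> D \<Longrightarrow> g \<epsilon> k > 0"
    "\<And>\<epsilon> k. 0 < \<epsilon> \<Longrightarrow> \<epsilon> < 1 \<Longrightarrow> k \<le> D \<Longrightarrow> column_sum E a (b(j := k)) (insert j F) y \<le> g \<epsilon> k"
    "\<And>\<epsilon> k. 0 < \<epsilon> \<Longrightarrow> \<epsilon> < 1 \<Longrightarrow> k + 2 \<le> D \<Longrightarrow> g \<epsilon> k * g \<epsilon> (k + 2) \<le> (g \<epsilon> (k + 1))\<^sup>2"
proof -
  define F' where "F' = insert j F"
  \<comment> \<open>Column coordinates start at the wanted margins and are used up; row coordinates
    start at \<open>0\<close> and fill up, so a row residual is the row sum.\<close>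
  define Y where "Y = (Inl ` insert j0 F' :: ('k + 'r) set)"
  define I where "I = Y \<union> Inr ` fst ` E"
  define dst where "dst = (\<lambda>c::'r \<times> 'k. Inl (if snd c \<in> F' then snd c else j0) :: 'k + 'r)"
  define src where "src = (\<lambda>c::'r \<times> 'k. Inr (fst c) :: 'k + 'r)"
  define wt where "wt = (\<lambda>c::'r \<times> 'k. if snd c \<in> F' then 1 else y (snd c))"
  \<comment> \<open>Powers of the distance between a residual and its target; at
    \<open>\<epsilon> = 0\<close> the convention \<open>0 ^ 0 = 1\<close> makes them
    indicators.\<close>
  define w where "w = (\<lambda>\<epsilon>::real. case_sum (\<lambda>_::'k. \<lambda>k::int. if k < 0 then 0 else \<epsilon> ^ nat k)
      (\<lambda>i k. \<epsilon> ^ nat \<bar>k - int (a i)\<bar>))"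
  \<comment> \<open>The reservoir \<open>j0\<close> starts with the mass \<open>D - k\<close> that
    is left for the open columns once column \<open>j\<close> takes \<open>k\<close>.\<close>
  define B where "B = (\<lambda>k. case_sum (\<lambda>j'. if j' = j then int k else if j' = j0 then int D - int k
      else int (b j')) (\<lambda>_::'r. 0 :: int))"
  have finI: "finite I" unfolding I_def Y_def F'_def using E F by auto
  have cs: "cell_system I Y E dst src wt"
    by unfold_locales (use finI E y in \<open>auto simp: I_def Y_def F'_def dst_def src_def wt_def\<close>)
  \<comment> \<open>\<open>residual\<close> and \<open>fillings\<close> do not depend on the
    weights, so this instance serves every \<open>\<epsilon>\<close>.\<close>
  interpret cell_system I Y E dst src wt "w 0" by (rule cs)
  define g where "g = (\<lambda>\<epsilon> k. cell_system.filling_sum I Y dst src wt (w \<epsilon>) E (B k))"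
  have g_eq: "g \<epsilon> k = (\<Sum>t\<in>fillings E (B k). (\<Prod>c\<in>E. wt c ^ t c) *
      (\<Prod>i\<in>I. w \<epsilon> i (residual E t (B k) i)))" for \<epsilon> k
    unfolding g_def by (simp add: cell_system.filling_sum_def[OF cs])
  have lc: "log_concave_cell_system I Y E dst src wt (w \<epsilon>)" if "0 < \<epsilon>" "\<epsilon> < 1" for \<epsilon>
  proof (rule log_concave_cell_system.intro[OF cs], unfold_locales)
    show "w \<epsilon> i k > 0" if "i \<in> I" "i \<in> Y \<Longrightarrow> k \<ge> 0" for i k
      using that \<open>0 < \<epsilon>\<close> unfolding w_def I_def Y_def by (cases i) auto
    show "w \<epsilon> i k = 0" if "i \<in> Y" "k < 0" for i k
      using that unfolding w_def Y_def by auto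
    show "w \<epsilon> i k * w \<epsilon> i (k + 2) \<le> (w \<epsilon> i (k + 1))\<^sup>2" for i k
    proof (cases i)
      case (Inl j')
      have "\<epsilon> ^ nat k * \<epsilon> ^ nat (k + 2) = (\<epsilon> ^ nat (k + 1))\<^sup>2" if "k \<ge> 0"
        using that by (simp add: nat_add_distrib power_add power2_eq_square)
      then show ?thesis using Inl \<open>0 < \<epsilon>\<close> unfolding w_def by auto
    next
      case (Inr i')
      then show ?thesis unfolding w_def using log_concave_power_dist[OF \<open>0 < \<epsilon>\<close> \<open>\<epsilon> < 1\<close>] by simp
    qed
  qed
  define T where "T = (\<lambda>k. tables E a (b(j := k)) F')"
  define hit where "hit = (\<lambda>k t. (\<forall>i\<in>Y. residual E t (B k) i = 0)
      \<and> (\<forall>i\<in>fst ` E. residual E t (B k) (Inr i) = int (a i)))"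
  have T_iff: "t \<in> T k \<longleftrightarrow> t \<in> fillings E (B k) \<and> hit k t" if k: "k \<le> D" for t k
  proof -
    have row: "residual E t (B k) (Inr i) = int (\<Sum>c\<in>{c\<in>E. fst c = i}. t c)" for i
    proof -
      have "Inr i \<notin> Y" unfolding Y_def by auto
      from residual_not_Y[OF order_refl this, of t "B k"] show ?thesis
        by (simp add: src_def B_def)
    qed
    have col: "residual E t (B k) (Inl j') = int ((b(j := k)) j') - int (\<Sum>c\<in>{c\<in>E. snd c = j'}. t c)"
      if "j' \<in> F'" for j'
    proof -
      have "{c\<in>E. dst c = Inl j'} = {c\<in>E. snd c = j'}"
        using that F unfolding dst_def F'_def by auto
      moreover have "B k (Inl j') = int ((b(j := k)) j')" using that F unfolding B_def F'_def by auto
      moreover have "Inl j' \<in> Y" using that unfolding Y_def by auto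
      ultimately show ?thesis by (simp add: residual_Y)
    qed
    have col0: "residual E t (B k) (Inl j0) = int D - int k - int (\<Sum>c\<in>{c\<in>E. snd c \<notin> F'}. t c)"
    proof -
      have "{c\<in>E. dst c = Inl j0} = {c\<in>E. snd c \<notin> F'}"
        using F unfolding dst_def F'_def by auto
      moreover have "B k (Inl j0) = int D - int k" using F unfolding B_def by auto
      ultimately show ?thesis by (simp add: residual_Y Y_def)
    qed
    \<comment> \<open>The reservoir empties automatically: its total follows from the rows, the
      other columns and \<open>D\<close>.\<close>
    have "residual E t (B k) (Inl j0) = 0" if t: "t \<in> T k"
    proof -
      have "(\<Sum>i\<in>fst ` E. a i) = (\<Sum>c\<in>E. t c)"
        unfolding sum_by_rows[OF E] using t unfolding T_def tables_def by (intro sum.cong) auto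
      also have "\<dots> = (\<Sum>j'\<in>F'. \<Sum>c\<in>{c\<in>E. snd c = j'}. t c) + (\<Sum>c\<in>{c\<in>E. snd c \<notin> F'}. t c)"
        using F by (intro sum_by_columns[OF E]) (simp add: F'_def)
      also have "(\<Sum>j'\<in>F'. \<Sum>c\<in>{c\<in>E. snd c = j'}. t c) = (\<Sum>j'\<in>F'. (b(j := k)) j')"
        using t unfolding T_def tables_def by (intro sum.cong) auto
      also have "\<dots> = k + (\<Sum>j'\<in>F. (b(j := k)) j')" unfolding F'_def using F by simp
      also have "(\<Sum>j'\<in>F. (b(j := k)) j') = (\<Sum>j'\<in>F. b j')" using F by (intro sum.cong) auto
      finally show ?thesis using D k col0 by simp
    qed
    moreover have "t \<in> T k \<longleftrightarrow> (\<forall>c. c \<notin> E \<longrightarrow> t c = 0)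
        \<and> (\<forall>i\<in>fst ` E. residual E t (B k) (Inr i) = int (a i))
        \<and> (\<forall>j'\<in>F'. residual E t (B k) (Inl j') = 0)"
      (is "_ \<longleftrightarrow> ?supp \<and> ?rows \<and> ?cols")
    proof -
      have rows: "?rows \<longleftrightarrow> (\<forall>i\<in>fst ` E. (\<Sum>c\<in>{c\<in>E. fst c = i}. t c) = a i)"
        unfolding row of_nat_eq_iff ..
      have cols: "?cols \<longleftrightarrow> (\<forall>j'\<in>F'. (\<Sum>c\<in>{c\<in>E. snd c = j'}. t c) = (b(j := k)) j')"
      proof (rule ball_cong[OF refl])
        fix j' assume "j' \<in> F'"
        from col[OF this] show "residual E t (B k) (Inl j') = 0 \<longleftrightarrow>
            (\<Sum>c\<in>{c\<in>E. snd c = j'}. t c) = (b(j := k)) j'" by linarith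
      qed
      show ?thesis unfolding T_def tables_def mem_Collect_eq rows cols by (rule refl)
    qed
    moreover have "(\<forall>i\<in>Y. residual E t (B k) i = 0) \<longleftrightarrow> residual E t (B k) (Inl j0) = 0
        \<and> (\<forall>j'\<in>F'. residual E t (B k) (Inl j') = 0)"
      unfolding Y_def by blast
    moreover have fill: "t \<in> fillings E (B k) \<and> hit k t \<longleftrightarrow> (\<forall>c. c \<notin> E \<longrightarrow> t c = 0) \<and> hit k t"
      unfolding fillings_def hit_def by auto
    ultimately show ?thesis unfolding fill unfolding hit_def by argo
  qed
  have w0: "(\<Prod>i\<in>I. w 0 i (residual E t (B k) i)) = of_bool (hit k t)"
    if t: "t \<in> fillings E (B k)" for t k
  proof (cases "hit k t")
    case True
    then have "w 0 i (residual E t (B k) i) = 1" if "i \<in> I" for i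
      using that unfolding hit_def I_def w_def Y_def by auto
    then show ?thesis using True by simp
  next
    case False
    then obtain i where i: "i \<in> I" "w 0 i (residual E t (B k) i) = 0"
    proof -
      consider i where "i \<in> Y" "residual E t (B k) i \<noteq> 0"
        | i where "i \<in> fst ` E" "residual E t (B k) (Inr i) \<noteq> int (a i)"
        using False unfolding hit_def by blast
      then show ?thesis
      proof cases
        case (1 i)
        then have "residual E t (B k) i > 0" using t unfolding fillings_def by force
        then show ?thesis using 1 that[of i] unfolding I_def Y_def w_def by auto
      next
        case (2 i)
        then show ?thesis using that[of "Inr i"] unfolding I_def w_def by auto
      qed
    qed
    then have "(\<Prod>i\<in>I. w 0 i (residual E t (B k) i)) = 0" using finI by (intro prod_zero) auto
    then show ?thesis using False by simp
  qed
  have w1: "(\<Prod>i\<in>I. w \<epsilon> i (residual E t (B k) i)) = 1" if "hit k t" for \<epsilon> t k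
    using that unfolding hit_def I_def w_def Y_def by (intro prod.neutral) auto
  have cs_eq: "column_sum E a (b(j := k)) (insert j F) y = (\<Sum>t\<in>T k. \<Prod>c\<in>E. wt c ^ t c)" for k
  proof -
    have "(\<Prod>c\<in>E. wt c ^ t c) = (\<Prod>c\<in>{c\<in>E. snd c \<notin> F'}. y (snd c) ^ t c)" for t
      using E unfolding wt_def by (simp add: prod.inter_filter if_distrib cong: if_cong) (intro prod.cong, auto)
    then show ?thesis unfolding column_sum_def T_def F'_def by simp
  qed
  have T_sub: "T k = {t \<in> fillings E (B k). hit k t}" if "k \<le> D" for k
    using T_iff[OF that] by auto
  have g0: "g 0 k = column_sum E a (b(j := k)) (insert j F) y" if k: "k \<le> D" for k
  proof -
    have "g 0 k = (\<Sum>t\<in>fillings E (B k). if hit k t then \<Prod>c\<in>E. wt c ^ t c else 0)"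
      unfolding g_eq using w0 by (intro sum.cong) auto
    then show ?thesis unfolding cs_eq T_sub[OF k] by (simp add: sum.inter_filter finite_fillings)
  qed
  show ?thesis
  proof (rule that[of g])
    fix k assume k: "k \<le> D"
    have "((\<lambda>\<epsilon>. w \<epsilon> i m) \<longlongrightarrow> w 0 i m) (at_right 0)" for i m
      unfolding w_def by (cases i) (auto intro!: tendsto_eq_intros)
    then have "((\<lambda>\<epsilon>. g \<epsilon> k) \<longlongrightarrow> g 0 k) (at_right 0)"
      unfolding g_eq by (intro tendsto_intros)
    then show "((\<lambda>\<epsilon>. g \<epsilon> k) \<longlongrightarrow> column_sum E a (b(j := k)) (insert j F) y) (at_right 0)"
      using g0[OF k] by simp
  next
    fix \<epsilon> :: real and k assume e: "0 < \<epsilon>" "\<epsilon> < 1" and k: "k \<le> D"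
    have "\<forall>i\<in>Y. B k i \<ge> 0" using k unfolding Y_def B_def by auto
    then show "g \<epsilon> k > 0"
      unfolding g_def using log_concave_cell_system.filling_sum_pos[OF lc[OF e] order_refl] by blast
    have w_nonneg: "w \<epsilon> i m \<ge> 0" for i m using e unfolding w_def by (cases i) auto
    have wt_nonneg: "wt c \<ge> 0" for c using y less_imp_le unfolding wt_def by auto
    have "(\<Sum>t\<in>T k. \<Prod>c\<in>E. wt c ^ t c) =
        (\<Sum>t\<in>T k. (\<Prod>c\<in>E. wt c ^ t c) * (\<Prod>i\<in>I. w \<epsilon> i (residual E t (B k) i)))"
      using w1 T_sub[OF k] by (intro sum.cong) auto
    also have "\<dots> \<le> g \<epsilon> k"
      unfolding g_eq T_sub[OF k] using w_nonneg wt_nonneg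
      by (intro sum_mono2 finite_fillings mult_nonneg_nonneg prod_nonneg) auto
    finally show "column_sum E a (b(j := k)) (insert j F) y \<le> g \<epsilon> k" unfolding cs_eq .
  next
    fix \<epsilon> :: real and k assume e: "0 < \<epsilon>" "\<epsilon> < 1" and k: "k + 2 \<le> D"
    \<comment> \<open>Adding \<open>2 e_j\<close>, \<open>e_j + e_j0\<close> and
      \<open>2 e_j0\<close> to it gives \<open>B (k + 2)\<close>, \<open>B (k + 1)\<close> and
      \<open>B k\<close>.\<close>
    define \<beta> where "\<beta> = case_sum (\<lambda>j'. if j' = j then int k else if j' = j0 then int D - int k - 2
      else int (b j')) (\<lambda>_::'r. 0 :: int)"
    have ij: "Inl j \<in> I" "Inl j0 \<in> I" unfolding I_def Y_def F'_def by auto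
    have \<beta>: "\<forall>i\<in>Y. \<beta> i \<ge> 0" using k unfolding Y_def \<beta>_def by auto
    have "bump (bump \<beta> (Inl j)) (Inl j) = B (k + 2)" "bump (bump \<beta> (Inl j0)) (Inl j0) = B k"
      "bump (bump \<beta> (Inl j)) (Inl j0) = B (k + 1)"
      using F(4) unfolding bump_def \<beta>_def B_def by (auto simp: fun_eq_iff split: sum.split)
    then show "g \<epsilon> k * g \<epsilon> (k + 2) \<le> (g \<epsilon> (k + 1))\<^sup>2"
      using log_concave_cell_system.filling_sum_log_concave[OF lc[OF e] \<beta> ij]
      unfolding g_def by (simp add: mult.commute)
  qed
qed

text \<open>One variable \<open>y j\<close> is varied at a time. As a polynomial in it, the column
  sum has coefficients that are limits of log-concave sequences, so
  \<open>log_concave_coefficient_bound\<close> can extract the one at \<open>b j\<close>. Column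
  \<open>j0\<close> stays open as the reservoir.\<close>

lemma column_elimination:
  fixes E :: "('r \<times> 'k) set"
  assumes E: "finite E" and F: "finite F" "F \<subseteq> snd ` E - {j0}" and j0: "j0 \<in> snd ` E"
    and total: "(\<Sum>j\<in>snd ` E. b j) = (\<Sum>i\<in>fst ` E. a i)"
    and base: "\<And>y. (\<And>j. y j > 0) \<Longrightarrow> C * (\<Prod>j\<in>snd ` E. y j ^ b j) \<le> column_sum E a b {} y"
    and y: "\<And>j. y j > 0"
  shows "C * (\<Prod>j\<in>F. exp (- hfun (real (b j)))) * (\<Prod>j\<in>snd ` E - F. y j ^ b j)
    \<le> column_sum E a b F y"
  using F y
proof (induction F arbitrary: y)
  case empty
  then show ?case using base[of y] by simp
next
  case (insert j F)
  let ?J = "snd ` E"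
  have J: "finite ?J" using E by simp
  have FJ: "F \<subseteq> ?J - {j0}" "j \<in> ?J" "j \<noteq> j0" "j0 \<notin> F" using insert by auto
  \<comment> \<open>The mass left for the columns outside \<open>F\<close>, hence a bound on the
    degree in \<open>y j\<close>.\<close>
  define D where "D = (\<Sum>j\<in>?J - F. b j)"
  have D: "(\<Sum>j\<in>F. b j) + D = (\<Sum>i\<in>fst ` E. a i)"
  proof -
    have "F \<subseteq> ?J" using FJ(1) by blast
    from sum.subset_diff[OF this J, of b] show ?thesis
      unfolding D_def total[symmetric] by simp
  qed
  have bD: "b j \<le> D" unfolding D_def using J FJ insert.hyps by (intro member_le_sum) auto
  have col_le: "(\<Sum>c\<in>{c\<in>E. snd c = j}. t c) \<le> D" if t: "t \<in> tables E a b F" for t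
  proof -
    have "(\<Sum>i\<in>fst ` E. a i) = (\<Sum>c\<in>E. t c)"
      unfolding sum_by_rows[OF E] using t unfolding tables_def by (intro sum.cong) auto
    also have "\<dots> = (\<Sum>j\<in>F. \<Sum>c\<in>{c\<in>E. snd c = j}. t c) + (\<Sum>c\<in>{c\<in>E. snd c \<notin> F}. t c)"
      using sum_by_columns[OF E insert.hyps(1)] .
    also have "(\<Sum>j\<in>F. \<Sum>c\<in>{c\<in>E. snd c = j}. t c) = (\<Sum>j\<in>F. b j)"
      using t unfolding tables_def by (intro sum.cong) auto
    finally have "(\<Sum>c\<in>{c\<in>E. snd c \<notin> F}. t c) = D" using D by simp
    moreover have "(\<Sum>c\<in>{c\<in>E. snd c = j}. t c) \<le> (\<Sum>c\<in>{c\<in>E. snd c \<notin> F}. t c)"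
      using E insert.hyps by (intro sum_mono2) auto
    ultimately show ?thesis by simp
  qed
  obtain g :: "real \<Rightarrow> nat \<Rightarrow> real" where
    lim: "\<And>k. k \<le> D \<Longrightarrow> ((\<lambda>\<epsilon>. g \<epsilon> k) \<longlongrightarrow> column_sum E a (b(j := k)) (insert j F) y) (at_right 0)"
    and pos: "\<And>\<epsilon> k. 0 < \<epsilon> \<Longrightarrow> \<epsilon> < 1 \<Longrightarrow> k \<le> D \<Longrightarrow> g \<epsilon> k > 0"
    and le: "\<And>\<epsilon> k. 0 < \<epsilon> \<Longrightarrow> \<epsilon> < 1 \<Longrightarrow> k \<le> D \<Longrightarrow> column_sum E a (b(j := k)) (insert j F) y \<le> g \<epsilon> k"
    and lc: "\<And>\<epsilon> k. 0 < \<epsilon> \<Longrightarrow> \<epsilon> < 1 \<Longrightarrow> k + 2 \<le> D \<Longrightarrow> g \<epsilon> k * g \<epsilon> (k + 2) \<le> (g \<epsilon> (k + 1))\<^sup>2"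
    using column_sum_log_concave_approx[where y = y, OF E insert.hyps(1,2) FJ(4,3) D insert.prems(2)] by blast
  define R where "R = C * (\<Prod>j\<in>F. exp (- hfun (real (b j)))) * (\<Prod>j'\<in>?J - insert j F. y j' ^ b j')"
  have R: "R * z ^ b j \<le> (\<Sum>k\<le>D. column_sum E a (b(j := k)) (insert j F) y * z ^ k)"
    if z: "z > 0" for z
  proof -
    define y' where "y' = y(j := z)"
    have y': "y' i > 0" for i using z insert.prems(2) unfolding y'_def by simp
    have J_F: "?J - F = insert j (?J - insert j F)" using FJ insert.hyps by auto
    have "(\<Prod>i\<in>?J - F. y' i ^ b i) = z ^ b j * (\<Prod>i\<in>?J - insert j F. y' i ^ b i)"
      by (subst J_F, subst prod.insert) (use J in \<open>auto simp: y'_def\<close>)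
    also have "(\<Prod>i\<in>?J - insert j F. y' i ^ b i) = (\<Prod>i\<in>?J - insert j F. y i ^ b i)"
      unfolding y'_def by (intro prod.cong) auto
    finally have "R * z ^ b j = C * (\<Prod>j\<in>F. exp (- hfun (real (b j)))) * (\<Prod>i\<in>?J - F. y' i ^ b i)"
      unfolding R_def by simp
    also have "\<dots> \<le> column_sum E a b F y'" using insert.IH[of y'] FJ(1) y' by blast
    also have "\<dots> = (\<Sum>k\<le>D. column_sum E a (b(j := k)) (insert j F) y' * y' j ^ k)"
      by (rule column_sum_split[OF E insert.hyps(2) col_le])
    also have "\<dots> = (\<Sum>k\<le>D. column_sum E a (b(j := k)) (insert j F) y * z ^ k)"
    proof -
      have "column_sum E a (b(j := k)) (insert j F) y' = column_sum E a (b(j := k)) (insert j F) y" for k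
        unfolding column_sum_def y'_def by (intro sum.cong prod.cong) auto
      then show ?thesis by (simp add: y'_def)
    qed
    finally show ?thesis .
  qed
  \<comment> \<open>The approximations dominate the true coefficients and so inherit the lower bound
    with \<open>R\<close>; the limit is then taken only at the index \<open>b j\<close>.\<close>
  have "exp (- hfun (real (b j))) * R \<le> g \<epsilon> (b j)" if e: "0 < \<epsilon>" "\<epsilon> < 1" for \<epsilon>
  proof (rule log_concave_coefficient_bound[where c = "g \<epsilon>" and D = D])
    show "R * z ^ b j \<le> (\<Sum>k\<le>D. g \<epsilon> k * z ^ k)" if "z > 0" for z
      using R[OF that] le[OF e] that
      by (elim order_trans) (auto intro!: sum_mono mult_right_mono)
  qed (use pos[OF e] lc[OF e] bD in auto)
  then have "\<forall>\<^sub>F \<epsilon> in at_right 0. exp (- hfun (real (b j))) * R \<le> g \<epsilon> (b j)"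
    by (auto simp: eventually_at_right_field intro!: exI[of _ 1])
  then have "exp (- hfun (real (b j))) * R \<le> column_sum E a (b(j := b j)) (insert j F) y"
    using tendsto_lowerbound[OF lim[OF bD]] by simp
  then show ?case using insert.hyps by (simp add: R_def mult_ac)
qed

section \<open>Complete homogeneous symmetric polynomials and the elimination of a row\<close>

definition complete_sym :: "'k set \<Rightarrow> ('k \<Rightarrow> real) \<Rightarrow> nat \<Rightarrow> real" where
  "complete_sym S y k =
    (\<Sum>s\<in>{s. (\<forall>j. j \<notin> S \<longrightarrow> s j = 0) \<and> (\<Sum>j\<in>S. s j) = k}. \<Prod>j\<in>S. y j ^ s j)"

lemma finite_compositions:
  assumes "finite S"
  shows "finite {s :: 'k \<Rightarrow> nat. (\<forall>j. j \<notin> S \<longrightarrow> s j = 0) \<and> (\<Sum>j\<in>S. s j) = k}"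
proof -
  have "{s :: 'k \<Rightarrow> nat. (\<forall>j. j \<notin> S \<longrightarrow> s j = 0) \<and> (\<Sum>j\<in>S. s j) = k}
      \<subseteq> {s. \<forall>j. (j \<in> S \<longrightarrow> s j \<in> {..k}) \<and> (j \<notin> S \<longrightarrow> s j = 0)}"
    using assms by (auto intro: member_le_sum)
  then show ?thesis using finite_set_of_finite_funs[OF assms, of "{..k}"] finite_subset by blast
qed

lemma complete_sym_empty: "complete_sym {} y k = of_bool (k = 0)"
proof -
  have "{s :: 'a \<Rightarrow> nat. (\<forall>j. s j = 0) \<and> 0 = k} = (if k = 0 then {\<lambda>_. 0} else {})" by auto
  then show ?thesis unfolding complete_sym_def by simp
qed

lemma complete_sym_insert:
  assumes S: "finite S" and j: "j \<notin> S"
  shows "complete_sym (insert j S) y k = (\<Sum>m\<le>k. y j ^ m * complete_sym S y (k - m))"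
proof -
  let ?C = "\<lambda>S k. {s :: 'a \<Rightarrow> nat. (\<forall>j. j \<notin> S \<longrightarrow> s j = 0) \<and> (\<Sum>j\<in>S. s j) = k}"
  have "finite (?C (insert j S) k)" using S by (intro finite_compositions) simp
  moreover have "(\<lambda>s. s j) ` ?C (insert j S) k \<subseteq> {..k}" using S j by auto
  ultimately have "complete_sym (insert j S) y k =
      (\<Sum>m\<le>k. \<Sum>s\<in>{s \<in> ?C (insert j S) k. s j = m}. \<Prod>j\<in>insert j S. y j ^ s j)"
    unfolding complete_sym_def by (intro sum.group[symmetric]) simp_all
  also have "\<dots> = (\<Sum>m\<le>k. y j ^ m * complete_sym S y (k - m))"
  proof (rule sum.cong[OF refl])
    fix m assume m: "m \<in> {..k}"
    have sum_upd: "(\<Sum>i\<in>S. (s(j := x)) i) = (\<Sum>i\<in>S. s i)" for s :: "'a \<Rightarrow> nat" and x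
      using j by (intro sum.cong) auto
    have prod_upd: "(\<Prod>i\<in>S. y i ^ (s(j := x)) i) = (\<Prod>i\<in>S. y i ^ s i)" for s :: "'a \<Rightarrow> nat" and x
      using j by (intro prod.cong) auto
    show "(\<Sum>s\<in>{s \<in> ?C (insert j S) k. s j = m}. \<Prod>j\<in>insert j S. y j ^ s j) =
        y j ^ m * complete_sym S y (k - m)"
      unfolding complete_sym_def sum_distrib_left
    proof (rule sum.reindex_bij_witness[where i = "\<lambda>s. s(j := m)" and j = "\<lambda>s. s(j := 0)"])
      fix s assume s: "s \<in> {s \<in> ?C (insert j S) k. s j = m}"
      then show "s(j := 0) \<in> ?C S (k - m)"
        unfolding mem_Collect_eq sum_upd using S j by auto
      show "y j ^ m * (\<Prod>i\<in>S. y i ^ (s(j := 0)) i) = (\<Prod>j\<in>insert j S. y j ^ s j)"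
        using s S j by (simp only: prod_upd) simp
    next
      fix s assume s: "s \<in> ?C S (k - m)"
      then show "(s(j := m))(j := 0) = s" using j by auto
      show "s(j := m) \<in> {s \<in> ?C (insert j S) k. s j = m}"
        using s S j m unfolding mem_Collect_eq by (simp add: sum_upd del: fun_upd_apply) auto
    qed auto
  qed
  finally show ?thesis .
qed

lemma complete_sym_insert_0:
  assumes "finite S" "j \<notin> S"
  shows "complete_sym (insert j S) y 0 = complete_sym S y 0"
  using complete_sym_insert[OF assms, of y 0] by simp

lemma complete_sym_insert_Suc:
  assumes "finite S" "j \<notin> S"
  shows "complete_sym (insert j S) y (Suc k) =
    complete_sym S y (Suc k) + y j * complete_sym (insert j S) y k"
  unfolding complete_sym_insert[OF assms] sum.atMost_Suc_shift
  by (simp add: sum_distrib_left mult_ac)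

lemma complete_sym_nonneg: "(\<And>j. y j > 0) \<Longrightarrow> complete_sym S y k \<ge> 0"
  unfolding complete_sym_def by (intro sum_nonneg prod_nonneg) (auto simp: less_imp_le)

lemma complete_sym_pos:
  assumes S: "finite S" "S \<noteq> {}" and y: "\<And>j. y j > 0"
  shows "complete_sym S y k > 0"
proof -
  obtain j where "j \<in> S" using S by blast
  then have ne: "(\<lambda>i. if i = j then k else 0) \<in> {s. (\<forall>j. j \<notin> S \<longrightarrow> s j = 0) \<and> (\<Sum>j\<in>S. s j) = k}"
    using S by auto
  show ?thesis
    unfolding complete_sym_def
  proof (rule sum_pos)
    show "{s. (\<forall>j. j \<notin> S \<longrightarrow> s j = 0) \<and> (\<Sum>j\<in>S. s j) = k} \<noteq> {}"
      by (metis (no_types, lifting) ne empty_iff)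
    show "(\<Prod>j\<in>S. y j ^ s j) > 0" for s :: "'a \<Rightarrow> nat" using y by (intro prod_pos) simp
  qed (rule finite_compositions[OF S(1)])
qed

text \<open>A new variable gives \<open>c' (k + 1) = c (k + 1) + y j * c' k\<close>. In the
  inequality for \<open>c'\<close> the terms with \<open>y j\<close> cancel, which leaves the mixed
  inequality \<open>step\<close>, proved by its own induction on \<open>k\<close>.\<close>

lemma complete_sym_log_concave:
  assumes S: "finite S" "S \<noteq> {}" and y: "\<And>j. y j > 0"
  shows "complete_sym S y k * complete_sym S y (k + 2) \<le> (complete_sym S y (k + 1))\<^sup>2"
  using S
proof (induction arbitrary: k rule: finite_ne_induct)
  case (singleton j)
  have "complete_sym {j} y k = y j ^ k" for k
  proof (induction k)
    case 0
    show ?case using complete_sym_insert_0[of "{}" j y] by (simp add: complete_sym_empty)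
  next
    case (Suc k)
    then show ?case using complete_sym_insert_Suc[of "{}" j y k] by (simp add: complete_sym_empty)
  qed
  then show ?case by (simp add: power2_eq_square power_add)
next
  case (insert j S)
  define c where "c = complete_sym S y"
  define c' where "c' = complete_sym (insert j S) y"
  have c: "c k > 0" for k unfolding c_def using complete_sym_pos insert y by blast
  have c': "c' k > 0" for k unfolding c'_def using complete_sym_pos[of "insert j S"] insert y by blast
  have rec: "c' 0 = c 0" "c' (Suc k) = c (Suc k) + y j * c' k" for k
    unfolding c_def c'_def
    using complete_sym_insert_0[OF insert.hyps(1,3)] complete_sym_insert_Suc[OF insert.hyps(1,3)] by simp_all
  have lc: "c k * c (Suc (Suc k)) \<le> c (Suc k) * c (Suc k)" for k
    using insert.IH[of k] unfolding c_def by (simp add: power2_eq_square)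
  have step: "c' k * c (Suc (Suc k)) \<le> c' (Suc k) * c (Suc k)" for k
  proof (induction k)
    case 0
    have "c 0 * c (Suc (Suc 0)) \<le> c (Suc 0) * c (Suc 0)" by (rule lc)
    also have "\<dots> \<le> c' (Suc 0) * c (Suc 0)"
      using c c' y rec by (intro mult_right_mono) (auto simp: less_imp_le)
    finally show ?case using rec by simp
  next
    case (Suc k)
    let ?a = "c (Suc k)" and ?b = "c (Suc (Suc k))" and ?d = "c (Suc (Suc (Suc k)))"
    have "?a * (c' k * ?d) \<le> c' k * (?b * ?b)"
      using lc[of "Suc k"] c'[of k] mult_left_mono[of "?a * ?d" "?b * ?b" "c' k"] by (simp add: mult_ac)
    also have "\<dots> \<le> ?a * (c' (Suc k) * ?b)"
      using Suc c[of "Suc (Suc k)"] mult_right_mono[OF Suc, of ?b] by (simp add: mult_ac)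
    finally have "c' k * ?d \<le> c' (Suc k) * ?b" using c[of "Suc k"] by simp
    then have "y j * (c' k * ?d) \<le> y j * (c' (Suc k) * ?b)"
      using y[of j] by (intro mult_left_mono) auto
    then show ?case
      using lc[of "Suc k"] unfolding rec(2)[of "Suc k"] by (simp add: rec(2)[of k] algebra_simps)
  qed
  have "c' k * c' (Suc (Suc k)) \<le> c' (Suc k) * c' (Suc k)"
    using step[of k] unfolding rec(2)[of "Suc k"] by (simp add: rec(2)[of k] algebra_simps)
  then show ?case unfolding c'_def by (simp add: power2_eq_square)
qed

lemma complete_sym_sums:
  assumes "finite S" and y: "\<And>j. y j > 0" and x: "x > 0" "\<And>j. j \<in> S \<Longrightarrow> x * y j < 1"
  shows "(\<lambda>k. complete_sym S y k * x ^ k) sums (\<Prod>j\<in>S. 1 / (1 - x * y j))"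
  using assms(1) x(2)
proof (induction S)
  case empty
  have "(\<lambda>k. complete_sym {} y k * x ^ k) = (\<lambda>k. if k = 0 then 1 else 0)"
    by (auto simp: complete_sym_empty)
  then show ?case using sums_single[of 0 "\<lambda>_. 1 :: real"] by simp
next
  case (insert j S)
  let ?a = "\<lambda>k. (x * y j) ^ k" and ?b = "\<lambda>k. complete_sym S y k * x ^ k"
  have a: "?a sums (1 / (1 - x * y j))"
    using insert.prems[of j] x(1) y[of j] by (intro geometric_sums) auto
  have b: "?b sums (\<Prod>j\<in>S. 1 / (1 - x * y j))" using insert by auto
  have "\<bar>?a k\<bar> = ?a k" "\<bar>?b k\<bar> = ?b k" for k
    using x(1) y[of j] complete_sym_nonneg[of y S k] y by (auto simp: abs_of_nonneg less_imp_le)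
  then have "(\<lambda>k. \<Sum>i\<le>k. ?a i * ?b (k - i)) sums ((\<Sum>k. ?a k) * (\<Sum>k. ?b k))"
    using a b by (intro Cauchy_product_sums) (simp_all add: sums_iff)
  moreover have "(\<Sum>i\<le>k. ?a i * ?b (k - i)) = complete_sym (insert j S) y k * x ^ k" for k
    unfolding complete_sym_insert[OF insert.hyps] sum_distrib_right
  proof (intro sum.cong refl)
    fix i assume "i \<in> {..k}"
    then have "x ^ k = x ^ i * x ^ (k - i)" by (simp flip: power_add)
    then show "?a i * ?b (k - i) = y j ^ i * complete_sym S y (k - i) * x ^ k"
      by (simp add: power_mult_distrib mult_ac)
  qed
  ultimately show ?case using a b insert.hyps by (simp add: sums_iff)
qed

text \<open>\<open>hfun_le\<close> bounds each factor of the generating function in one row variable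
  \<open>x\<close> from below, and the geometric majorant touching at \<open>a\<close> isolates one
  coefficient. The series is infinite, so convergence at the chosen \<open>x\<close> has to be
  secured.\<close>

lemma complete_sym_lower_bound:
  assumes S: "finite S" "S \<noteq> {}" and y: "\<And>j. y j > 0"
    and M: "\<And>j. j \<in> S \<Longrightarrow> M j \<ge> 0" "(\<Sum>j\<in>S. M j) = real a"
  shows "exp (- hfun (real a)) * (\<Prod>j\<in>S. exp (hfun (M j)) * y j powr M j) \<le> complete_sym S y a"
proof (rule hfun_bound_of_all)
  fix z :: real assume z: "0 < z" "z < 1"
  let ?c = "complete_sym S y"
  have c: "?c k > 0" for k using complete_sym_pos[where y = y, OF S y] .
  define r where "r = ?c (Suc a) / ?c a"
  have r: "r > 0" unfolding r_def using c by simp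
  have anti: "?c (Suc n) / ?c n \<le> ?c (Suc m) / ?c m" if "m \<le> n" for m n
    using log_concave_ratio_antimono[of "Suc n" ?c m n] c complete_sym_log_concave[where y = y, OF S y] that by simp
  have maj: "?c k * r ^ a \<le> ?c a * r ^ k" for k
  proof (rule geometric_majorant[OF r, where D = k])
    show "?c (Suc m) \<le> r * ?c m" if "a \<le> m" for m
      using anti[OF that] c[of m] unfolding r_def[symmetric] by (simp add: field_simps)
    show "r * ?c m \<le> ?c (Suc m)" if "m < a" for m
      using anti[of m a] that c[of m] unfolding r_def[symmetric] by (simp add: field_simps)
  qed simp
  \<comment> \<open>Multiplying the monomials of degree \<open>a\<close> by \<open>y j\<close> gives
    part of those of degree \<open>a + 1\<close>, so the ratio \<open>r\<close> is at least
    \<open>y j\<close>; hence \<open>x = z / r\<close> lies in the region of convergence.\<close>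
  have yr: "y j \<le> r" if "j \<in> S" for j
  proof -
    have "insert j (S - {j}) = S" using that by auto
    then have "?c (Suc a) = complete_sym (S - {j}) y (Suc a) + y j * ?c a"
      using complete_sym_insert_Suc[of "S - {j}" j y a] S by simp
    then show ?thesis
      using complete_sym_nonneg[of y "S - {j}" "Suc a"] y c[of a] unfolding r_def by (simp add: field_simps)
  qed
  define x where "x = z / r"
  have x: "x > 0" unfolding x_def using z r by simp
  have xy: "0 < x * y j" "x * y j < 1" if "j \<in> S" for j
  proof -
    show "0 < x * y j" using x y by simp
    have "x * y j \<le> x * r" using yr[OF that] x by (intro mult_left_mono) auto
    moreover have "x * r = z" unfolding x_def using r by simp
    ultimately show "x * y j < 1" using z by linarith
  qed
  have cell: "(\<Prod>j\<in>S. exp (hfun (M j)) * (x * y j) powr M j) \<le> (\<Prod>j\<in>S. 1 / (1 - x * y j))"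
  proof (intro prod_mono conjI)
    fix j assume j: "j \<in> S"
    have "exp (hfun (M j)) * (x * y j) powr M j = exp (hfun (M j) + M j * ln (x * y j))"
      using x y[of j] by (simp add: powr_def exp_add)
    also have "\<dots> \<le> exp (- ln (1 - x * y j))"
      using hfun_le[OF M(1)[OF j] xy[OF j]] by simp
    also have "\<dots> = 1 / (1 - x * y j)" using xy[OF j] by (simp add: exp_minus field_simps)
    finally show "exp (hfun (M j)) * (x * y j) powr M j \<le> 1 / (1 - x * y j)" .
  qed simp
  have scale: "(\<Prod>j\<in>S. exp (hfun (M j)) * (x * y j) powr M j) =
      x ^ a * (\<Prod>j\<in>S. exp (hfun (M j)) * y j powr M j)"
  proof -
    have "(\<Prod>j\<in>S. exp (hfun (M j)) * (x * y j) powr M j) =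
        (\<Prod>j\<in>S. x powr M j) * (\<Prod>j\<in>S. exp (hfun (M j)) * y j powr M j)"
      unfolding prod.distrib[symmetric]
      using x y by (intro prod.cong) (simp_all add: powr_mult less_imp_le)
    moreover have "(\<Prod>j\<in>S. x powr M j) = x ^ a"
      using x S(1) M(2) powr_sum[of x M S] by (simp add: powr_realpow)
    ultimately show ?thesis by simp
  qed
  have series: "(\<Prod>j\<in>S. 1 / (1 - x * y j)) * r ^ a \<le> ?c a * (1 / (1 - z))"
  proof (rule sums_le)
    show "(\<lambda>k. (?c k * x ^ k) * r ^ a) sums ((\<Prod>j\<in>S. 1 / (1 - x * y j)) * r ^ a)"
      using complete_sym_sums[where y = y, OF S(1) y x xy(2)] by (intro sums_mult2)
    show "(\<lambda>k. ?c a * z ^ k) sums (?c a * (1 / (1 - z)))"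
      using z by (intro sums_mult geometric_sums) auto
    fix k
    have "?c k * x ^ k * r ^ a \<le> (?c a * r ^ k) * x ^ k"
      using mult_right_mono[OF maj[of k], of "x ^ k"] x by (simp add: mult_ac)
    also have "\<dots> = ?c a * z ^ k" unfolding x_def using r by (simp add: power_divide)
    finally show "?c k * x ^ k * r ^ a \<le> ?c a * z ^ k" .
  qed
  have "(x ^ a * (\<Prod>j\<in>S. exp (hfun (M j)) * y j powr M j)) * r ^ a
      \<le> (\<Prod>j\<in>S. 1 / (1 - x * y j)) * r ^ a"
    using r cell unfolding scale by (intro mult_right_mono) auto
  also note series
  finally have "(x ^ a * (\<Prod>j\<in>S. exp (hfun (M j)) * y j powr M j)) * r ^ a \<le> ?c a * (1 / (1 - z))" .
  moreover have xr: "x ^ a * r ^ a = z ^ a" unfolding x_def using r by (simp add: power_divide)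
  ultimately have "z ^ a * (\<Prod>j\<in>S. exp (hfun (M j)) * y j powr M j) \<le> ?c a * (1 / (1 - z))"
    unfolding xr[symmetric] by (simp add: mult_ac)
  then have "(1 - z) * (z ^ a * (\<Prod>j\<in>S. exp (hfun (M j)) * y j powr M j))
      \<le> (1 - z) * (?c a * (1 / (1 - z)))"
    using z by (intro mult_left_mono) auto
  also have "\<dots> = ?c a" using z by simp
  finally show "(1 - z) * z ^ a * (\<Prod>j\<in>S. exp (hfun (M j)) * y j powr M j) \<le> ?c a"
    by (simp only: mult.assoc)
qed

text \<open>Without column constraints a table is an independent choice of its rows, so the sum
  factors.\<close>

lemma column_sum_no_columns:
  fixes E :: "('r \<times> 'k) set"
  assumes E: "finite E"
  shows "column_sum E a b {} y = (\<Prod>i\<in>fst ` E. complete_sym (E `` {i}) y (a i))"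
proof -
  let ?C = "\<lambda>i. {s :: 'k \<Rightarrow> nat. (\<forall>j. j \<notin> E `` {i} \<longrightarrow> s j = 0) \<and> (\<Sum>j\<in>E `` {i}. s j) = a i}"
  have fin: "finite (E `` {i})" for i using E by (rule finite_Image)
  have row: "{c\<in>E. fst c = i} = Pair i ` (E `` {i})" for i by force
  have sum_row: "(\<Sum>c\<in>{c\<in>E. fst c = i}. t c) = (\<Sum>j\<in>E `` {i}. t (i, j))" for t :: "'r \<times> 'k \<Rightarrow> nat" and i
    unfolding row by (subst sum.reindex) (auto simp: inj_on_def)
  have prod_rows: "(\<Prod>c\<in>E. y (snd c) ^ t c) = (\<Prod>i\<in>fst ` E. \<Prod>j\<in>E `` {i}. y j ^ t (i, j))"
    for t :: "'r \<times> 'k \<Rightarrow> nat"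
  proof -
    have "(\<Prod>c\<in>E. y (snd c) ^ t c) = (\<Prod>i\<in>fst ` E. \<Prod>c\<in>{c\<in>E. fst c = i}. y (snd c) ^ t c)"
      using E by (subst prod.group) auto
    also have "\<dots> = (\<Prod>i\<in>fst ` E. \<Prod>j\<in>E `` {i}. y j ^ t (i, j))"
      unfolding row by (subst prod.reindex) (auto simp: inj_on_def)
    finally show ?thesis .
  qed
  have "(\<Prod>i\<in>fst ` E. complete_sym (E `` {i}) y (a i)) =
      (\<Sum>\<sigma>\<in>PiE (fst ` E) ?C. \<Prod>i\<in>fst ` E. \<Prod>j\<in>E `` {i}. y j ^ \<sigma> i j)"
    unfolding complete_sym_def
  proof (rule prod_sum_PiE)
    show "finite (fst ` E)" using E by simp
    show "finite (?C i)" for i by (rule finite_compositions[OF fin])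
  qed
  also have "\<dots> = column_sum E a b {} y"
    unfolding column_sum_def
  proof (rule sum.reindex_bij_witness[where
        i = "\<lambda>t. \<lambda>i\<in>fst ` E. \<lambda>j. t (i, j)" and
        \<comment> \<open>Members of \<open>PiE\<close> are \<open>undefined\<close> outside the row
          set, where a table has to be \<open>0\<close>.\<close>
        j = "\<lambda>\<sigma> c. if fst c \<in> fst ` E then \<sigma> (fst c) (snd c) else 0"])
    fix \<sigma> assume \<sigma>: "\<sigma> \<in> PiE (fst ` E) ?C"
    then have \<sigma>i: "\<sigma> i \<in> ?C i" if "i \<in> fst ` E" for i using that by (rule PiE_mem)
    show "(\<lambda>i\<in>fst ` E. \<lambda>j. if fst (i, j) \<in> fst ` E then \<sigma> (fst (i, j)) (snd (i, j)) else 0) = \<sigma>"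
    proof
      fix i
      show "(\<lambda>i\<in>fst ` E. \<lambda>j. if fst (i, j) \<in> fst ` E then \<sigma> (fst (i, j)) (snd (i, j)) else 0) i = \<sigma> i"
        using PiE_arb[OF \<sigma>, of i] by (cases "i \<in> fst ` E") simp_all
    qed
    show "(\<lambda>c. if fst c \<in> fst ` E then \<sigma> (fst c) (snd c) else 0) \<in> tables E a b {}"
      unfolding tables_def sum_row mem_Collect_eq
    proof (intro conjI allI impI ballI)
      fix c assume "c \<notin> E"
      then show "(if fst c \<in> fst ` E then \<sigma> (fst c) (snd c) else 0) = 0"
        using \<sigma>i[of "fst c"] by (cases "fst c \<in> fst ` E") auto
    next
      fix i assume "i \<in> fst ` E"
      then show "(\<Sum>j\<in>E `` {i}. if fst (i, j) \<in> fst ` E then \<sigma> (fst (i, j)) (snd (i, j)) else 0) = a i"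
        using \<sigma>i[of i] by simp
    qed simp
    show "(\<Prod>c\<in>{c \<in> E. snd c \<notin> {}}. y (snd c) ^ (if fst c \<in> fst ` E then \<sigma> (fst c) (snd c) else 0)) =
        (\<Prod>i\<in>fst ` E. \<Prod>j\<in>E `` {i}. y j ^ \<sigma> i j)"
      using prod_rows[of "\<lambda>c. if fst c \<in> fst ` E then \<sigma> (fst c) (snd c) else 0"] by simp
  next
    fix t assume t: "t \<in> tables E a b {}"
    show "(\<lambda>c. if fst c \<in> fst ` E then (\<lambda>i\<in>fst ` E. \<lambda>j. t (i, j)) (fst c) (snd c) else 0) = t"
    proof
      fix c
      have "t c = 0" if "fst c \<notin> fst ` E"
        using t that imageI[of c E fst] unfolding tables_def by blast
      then show "(if fst c \<in> fst ` E then (\<lambda>i\<in>fst ` E. \<lambda>j. t (i, j)) (fst c) (snd c) else 0) = t c"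
        by (cases "fst c \<in> fst ` E") simp_all
    qed
    show "(\<lambda>i\<in>fst ` E. \<lambda>j. t (i, j)) \<in> PiE (fst ` E) ?C"
    proof (rule PiE_I)
      fix i assume i: "i \<in> fst ` E"
      have "t (i, j) = 0" if "j \<notin> E `` {i}" for j using t that unfolding tables_def by blast
      moreover have "(\<Sum>j\<in>E `` {i}. t (i, j)) = a i"
        using t i unfolding tables_def sum_row by blast
      ultimately show "(\<lambda>i\<in>fst ` E. \<lambda>j. t (i, j)) i \<in> ?C i" using i by simp
    qed simp
  qed
  finally show ?thesis ..
qed

lemma sum_by_all_columns:
  fixes t :: "'r \<times> 'k \<Rightarrow> 'm::comm_monoid_add"
  assumes "finite E"
  shows "(\<Sum>c\<in>E. t c) = (\<Sum>j\<in>snd ` E. \<Sum>c\<in>{c\<in>E. snd c = j}. t c)"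
  using assms by (subst sum.group) auto

text \<open>No factor is lost for the column \<open>j0\<close>, whose margin is determined by all the others.\<close>

lemma card_tables_lower_bound:
  fixes E :: "('r \<times> 'k) set" and M :: "'r \<times> 'k \<Rightarrow> real"
  assumes E: "finite E" and j0: "j0 \<in> snd ` E" and M: "\<And>c. c \<in> E \<Longrightarrow> M c \<ge> 0"
    and rows: "\<And>i. i \<in> fst ` E \<Longrightarrow> (\<Sum>c\<in>{c\<in>E. fst c = i}. M c) = real (a i)"
    and cols: "\<And>j. j \<in> snd ` E \<Longrightarrow> (\<Sum>c\<in>{c\<in>E. snd c = j}. M c) = real (b j)"
  shows "exp (\<Sum>c\<in>E. hfun (M c)) * (\<Prod>i\<in>fst ` E. exp (- hfun (real (a i))))
      * (\<Prod>j\<in>snd ` E - {j0}. exp (- hfun (real (b j)))) \<le> real (card (tables E a b (snd ` E)))"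
proof -
  let ?J = "snd ` E" and ?R = "fst ` E"
  define C where "C = exp (\<Sum>c\<in>E. hfun (M c)) * (\<Prod>i\<in>?R. exp (- hfun (real (a i))))"
  have fJ: "finite ?J" using E by simp
  have "(\<Sum>j\<in>?J. real (b j)) = (\<Sum>c\<in>E. M c)" unfolding sum_by_all_columns[OF E] using cols by simp
  also have "\<dots> = (\<Sum>i\<in>?R. real (a i))" unfolding sum_by_rows[OF E] using rows by simp
  finally have "real (\<Sum>j\<in>?J. b j) = real (\<Sum>i\<in>?R. a i)" by simp
  then have total: "(\<Sum>j\<in>?J. b j) = (\<Sum>i\<in>?R. a i)" by (simp only: of_nat_eq_iff)
  \<comment> \<open>Columnwise, the powers of \<open>y\<close> with exponents \<open>M\<close>
    multiply to the monomial of the margins; rowwise, \<open>complete_sym_lower_bound\<close>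
    applies.\<close>
  have base: "C * (\<Prod>j\<in>?J. y j ^ b j) \<le> column_sum E a b {} y" if y: "\<And>j. y j > 0" for y
  proof -
    let ?row = "\<lambda>i. {c\<in>E. fst c = i}"
    have row: "?row i = Pair i ` (E `` {i})" for i by force
    have "(\<Prod>j\<in>?J. y j ^ b j) = (\<Prod>j\<in>?J. \<Prod>c\<in>{c\<in>E. snd c = j}. y (snd c) powr M c)"
    proof (rule prod.cong[OF refl])
      fix j assume j: "j \<in> ?J"
      have "(\<Prod>c\<in>{c\<in>E. snd c = j}. y (snd c) powr M c) = (\<Prod>c\<in>{c\<in>E. snd c = j}. y j powr M c)"
        by (intro prod.cong) auto
      also have "\<dots> = y j powr real (b j)"
        using E y[of j] cols[OF j] powr_sum[of "y j" M "{c\<in>E. snd c = j}"] by simp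
      also have "\<dots> = y j ^ b j" using y by (simp add: powr_realpow)
      finally show "y j ^ b j = (\<Prod>c\<in>{c\<in>E. snd c = j}. y (snd c) powr M c)" by simp
    qed
    also have "\<dots> = (\<Prod>c\<in>E. y (snd c) powr M c)" using E by (subst prod.group) auto
    finally have "C * (\<Prod>j\<in>?J. y j ^ b j) =
        (\<Prod>i\<in>?R. exp (- hfun (real (a i)))) * (\<Prod>c\<in>E. exp (hfun (M c)) * y (snd c) powr M c)"
      unfolding C_def using E by (simp add: exp_sum prod.distrib mult_ac)
    also have "(\<Prod>c\<in>E. exp (hfun (M c)) * y (snd c) powr M c) =
        (\<Prod>i\<in>?R. \<Prod>c\<in>?row i. exp (hfun (M c)) * y (snd c) powr M c)"
      using E by (subst prod.group) auto
    also have "\<dots> = (\<Prod>i\<in>?R. \<Prod>j\<in>E `` {i}. exp (hfun (M (i, j))) * y j powr M (i, j))"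
      unfolding row by (subst prod.reindex) (auto simp: inj_on_def)
    also have "(\<Prod>i\<in>?R. exp (- hfun (real (a i)))) * \<dots> =
        (\<Prod>i\<in>?R. exp (- hfun (real (a i))) * (\<Prod>j\<in>E `` {i}. exp (hfun (M (i, j))) * y j powr M (i, j)))"
      by (simp add: prod.distrib)
    also have "\<dots> \<le> (\<Prod>i\<in>?R. complete_sym (E `` {i}) y (a i))"
    proof (intro prod_mono conjI)
      fix i assume i: "i \<in> ?R"
      show "exp (- hfun (real (a i))) * (\<Prod>j\<in>E `` {i}. exp (hfun (M (i, j))) * y j powr M (i, j))
          \<le> complete_sym (E `` {i}) y (a i)"
      proof (rule complete_sym_lower_bound[where y = y, OF _ _ y])
        show "finite (E `` {i})" using E by (rule finite_Image)
        show "E `` {i} \<noteq> {}" using i by auto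
        show "(\<Sum>j\<in>E `` {i}. M (i, j)) = real (a i)"
          using rows[OF i] unfolding row by (subst (asm) sum.reindex) (auto simp: inj_on_def)
      qed (use M in auto)
    qed (auto intro!: mult_nonneg_nonneg prod_nonneg)
    finally show ?thesis unfolding column_sum_no_columns[OF E] .
  qed
  let ?F = "?J - {j0}"
  have "C * (\<Prod>j\<in>?F. exp (- hfun (real (b j)))) * (\<Prod>j\<in>?J - ?F. 1 ^ b j) \<le> column_sum E a b ?F (\<lambda>_. 1)"
    using column_elimination[OF E _ order_refl j0 total base, of "\<lambda>_. 1"] fJ by simp
  moreover have "column_sum E a b ?F (\<lambda>_. 1) = real (card (tables E a b ?F))"
    unfolding column_sum_def by simp
  moreover have "tables E a b ?F = tables E a b ?J"
  proof
    show "tables E a b ?J \<subseteq> tables E a b ?F" unfolding tables_def by auto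
    show "tables E a b ?F \<subseteq> tables E a b ?J"
    proof
      fix t assume t: "t \<in> tables E a b ?F"
      let ?col = "\<lambda>j. \<Sum>c\<in>{c\<in>E. snd c = j}. t c"
      have "(\<Sum>j\<in>?J. b j) = (\<Sum>c\<in>E. t c)"
        unfolding total sum_by_rows[OF E] using t unfolding tables_def by (intro sum.cong) auto
      also have "\<dots> = (\<Sum>j\<in>?J. ?col j)" by (rule sum_by_all_columns[OF E])
      also have "\<dots> = ?col j0 + (\<Sum>j\<in>?F. ?col j)" using fJ j0 by (rule sum.remove)
      also have "(\<Sum>j\<in>?F. ?col j) = (\<Sum>j\<in>?F. b j)" using t unfolding tables_def by (intro sum.cong) auto
      finally have "?col j0 = b j0" using sum.remove[OF fJ j0, of b] by simp
      then show "t \<in> tables E a b ?J" using t unfolding tables_def by auto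
    qed
  qed
  ultimately show ?thesis unfolding C_def by simp
qed

section \<open>Flows\<close>

text \<open>\<open>Q\<close> below is the probability of a table when its entries are independent geometric variables
  with the mean entries of \<open>T\<close>. The average of \<open>ln Q\<close> over \<open>T\<close> is minus the entropy, and \<open>Q\<close> sums to at most 1.\<close>

lemma card_le_exp_entropy:
  fixes T :: "('c \<Rightarrow> nat) set"
  assumes E: "finite E" and T: "finite T" "T \<noteq> {}" and supp: "\<And>t c. t \<in> T \<Longrightarrow> c \<notin> E \<Longrightarrow> t c = 0"
  shows "real (card T) \<le> exp (\<Sum>c\<in>E. hfun ((\<Sum>t\<in>T. real (t c)) / real (card T)))"
proof -
  let ?K = "real (card T)"
  define m where "m = (\<lambda>c. (\<Sum>t\<in>T. real (t c)) / ?K)"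
  \<comment> \<open>For \<open>m c = 0\<close> the convention \<open>0 ^ 0 = 1\<close> makes this
    the point mass at \<open>0\<close>.\<close>
  define q where "q = (\<lambda>c k. 1 / (1 + m c) * (m c / (1 + m c)) ^ k)"
  define Q where "Q = (\<lambda>t. \<Prod>c\<in>E. q c (t c))"
  define \<mu> where "\<mu> = - (\<Sum>c\<in>E. hfun (m c))"
  have K: "?K > 0" using T by (simp add: card_gt_0_iff)
  have m: "m c \<ge> 0" for c unfolding m_def by (simp add: sum_nonneg)
  have q_nonneg: "q c k \<ge> 0" for c k unfolding q_def using m[of c] by simp
  have m0: "t c = 0" if "m c = 0" "t \<in> T" for c t
  proof -
    have "(\<Sum>t\<in>T. real (t c)) = 0" using that(1) K unfolding m_def by simp
    then show ?thesis using T(1) that(2) by (simp add: sum_nonneg_eq_0_iff)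
  qed
  have q_pos: "q c (t c) > 0" if "t \<in> T" for c t
  proof (cases "m c = 0")
    case True
    then show ?thesis using m0[OF True that] unfolding q_def by simp
  next
    case False
    then have "m c > 0" using m[of c] by simp
    then show ?thesis unfolding q_def by simp
  qed
  have mean_ln: "(\<Sum>t\<in>T. ln (q c (t c))) = - ?K * hfun (m c)" for c
  proof (cases "m c = 0")
    case True
    then have "ln (q c (t c)) = 0" if "t \<in> T" for t using m0[OF True that] unfolding q_def by simp
    then show ?thesis using True by (simp add: hfun_def)
  next
    case False
    then have mc: "m c > 0" using m[of c] by simp
    have "ln (q c (t c)) = - ln (1 + m c) + real (t c) * (ln (m c) - ln (1 + m c))" for t
      unfolding q_def using mc by (simp add: ln_mult ln_div ln_realpow)
    then have "(\<Sum>t\<in>T. ln (q c (t c))) =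
        - ?K * ln (1 + m c) + (\<Sum>t\<in>T. real (t c)) * (ln (m c) - ln (1 + m c))"
      by (simp add: sum_subtractf sum_distrib_right)
    also have "(\<Sum>t\<in>T. real (t c)) = ?K * m c" unfolding m_def using K by simp
    also have "- ?K * ln (1 + m c) + ?K * m c * (ln (m c) - ln (1 + m c)) = - ?K * hfun (m c)"
      using mc by (simp add: hfun_def algebra_simps)
    finally show ?thesis .
  qed
  have "(\<Sum>t\<in>T. ln (Q t)) = (\<Sum>t\<in>T. \<Sum>c\<in>E. ln (q c (t c)))"
  proof (rule sum.cong[OF refl])
    fix t assume "t \<in> T"
    then have "q c (t c) \<noteq> 0" for c using q_pos[of t c] by simp
    then show "ln (Q t) = (\<Sum>c\<in>E. ln (q c (t c)))" unfolding Q_def using E by (intro ln_prod)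
  qed
  also have "\<dots> = (\<Sum>c\<in>E. - ?K * hfun (m c))" by (subst sum.swap) (simp add: mean_ln)
  also have "\<dots> = ?K * \<mu>" unfolding \<mu>_def by (simp add: sum_distrib_left sum_negf)
  finally have mean: "(\<Sum>t\<in>T. ln (Q t)) = ?K * \<mu>" .
  have Qpos: "Q t > 0" if "t \<in> T" for t unfolding Q_def using q_pos[OF that] by (intro prod_pos) auto
  \<comment> \<open>The tangent of the exponential at \<open>\<mu>\<close>, the mean of
    \<open>ln (Q t)\<close> over \<open>T\<close>: the linear terms sum to zero, which does the work
    of Jensen's inequality.\<close>
  have tangent: "exp \<mu> * (1 + (ln (Q t) - \<mu>)) \<le> Q t" if t: "t \<in> T" for t
  proof -
    have "exp \<mu> * (1 + (ln (Q t) - \<mu>)) \<le> exp \<mu> * exp (ln (Q t) - \<mu>)"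
      by (intro mult_left_mono exp_ge_add_one_self) simp
    also have "\<dots> = Q t" using Qpos[OF t] by (simp flip: exp_add)
    finally show ?thesis .
  qed
  have "exp \<mu> * ?K = (\<Sum>t\<in>T. exp \<mu> * (1 + (ln (Q t) - \<mu>)))"
    by (simp add: sum_distrib_left[symmetric] sum.distrib sum_subtractf mean)
  also have "\<dots> \<le> (\<Sum>t\<in>T. Q t)" using tangent by (intro sum_mono) auto
  also have "\<dots> \<le> 1"
  proof -
    define B where "B = Max (\<Union>t\<in>T. t ` E \<union> {0})"
    have B: "t c \<le> B" if "t \<in> T" "c \<in> E" for t c
      unfolding B_def using that E T by (intro Max_ge) auto
    let ?r = "\<lambda>t. restrict t E"
    have inj: "inj_on ?r T"
    proof (rule inj_onI)
      fix t t' assume t: "t \<in> T" "t' \<in> T" "?r t = ?r t'"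
      show "t = t'"
      proof
        fix c show "t c = t' c"
          using fun_cong[OF t(3), of c] supp[OF t(1), of c] supp[OF t(2), of c] by (cases "c \<in> E") auto
      qed
    qed
    have "(\<Sum>t\<in>T. Q t) = (\<Sum>s\<in>?r ` T. Q s)"
      unfolding sum.reindex[OF inj] o_def Q_def by (intro sum.cong prod.cong) auto
    also have "\<dots> \<le> (\<Sum>s\<in>PiE E (\<lambda>_. {..B}). Q s)"
    proof (rule sum_mono2)
      show "finite (PiE E (\<lambda>_. {..B}))" using E by (intro finite_PiE) auto
      show "?r ` T \<subseteq> PiE E (\<lambda>_. {..B})" using B by auto
      show "Q s \<ge> 0" for s unfolding Q_def using q_nonneg by (intro prod_nonneg) auto
    qed
    also have "\<dots> = (\<Prod>c\<in>E. \<Sum>k\<le>B. q c k)"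
      unfolding Q_def using E by (intro prod_sum_PiE[symmetric]) auto
    also have "\<dots> \<le> 1"
    proof (intro prod_le_1 conjI)
      fix c assume "c \<in> E"
      show "0 \<le> (\<Sum>k\<le>B. q c k)" using q_nonneg by (intro sum_nonneg) auto
      define x where "x = m c / (1 + m c)"
      have x: "x \<ge> 0" and one_minus: "1 / (1 + m c) = 1 - x"
        unfolding x_def using m[of c] by (simp_all add: field_simps)
      have "(\<Sum>k\<le>B. q c k) = (1 - x) * (\<Sum>k<Suc B. x ^ k)"
        unfolding q_def x_def[symmetric] one_minus by (simp add: sum_distrib_left lessThan_Suc_atMost)
      also have "\<dots> = 1 - x ^ Suc B" by (simp only: one_diff_power_eq)
      also have "\<dots> \<le> 1" using x by simp
      finally show "(\<Sum>k\<le>B. q c k) \<le> 1" .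
    qed
    finally show ?thesis .
  qed
  finally have "exp \<mu> * ?K * exp (- \<mu>) \<le> 1 * exp (- \<mu>)" by (intro mult_right_mono) auto
  then show ?thesis unfolding \<mu>_def m_def by (simp add: exp_minus field_simps)
qed

text \<open>The edges and a diagonal cell for each inner vertex; \<open>(0, 0)\<close> and
  \<open>(n, n)\<close> are left out because nothing passes over an end vertex.\<close>

definition flow_cells :: "nat \<Rightarrow> (nat \<times> nat) set" where
  "flow_cells n = {(i, j). i < j \<and> j \<le> n} \<union> {(i, j). i = j \<and> 0 < j \<and> j < n}"

text \<open>A flow corresponds to a table with row margins \<open>s\<^sub>0, \<dots>, s\<^bsub>n-1\<^esub>\<close> for rows \<open>0, \<dots>, n - 1\<close> and the same
  column margins for columns \<open>1, \<dots>, n\<close>: the entry \<open>(j, j)\<close> is the amount of flow that passes over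
  the vertex \<open>j\<close>.\<close>

definition flow_table :: "(nat \<Rightarrow> int) \<Rightarrow> (nat \<Rightarrow> nat \<Rightarrow> real) \<Rightarrow> nat \<times> nat \<Rightarrow> real" where
  "flow_table N f c = (if fst c < snd c then f (fst c) (snd c)
     else (\<Sum>k<snd c. real_of_int (N k) - f k (snd c)))"

definition table_flow :: "nat \<Rightarrow> (nat \<times> nat \<Rightarrow> real) \<Rightarrow> nat \<Rightarrow> nat \<Rightarrow> real" where
  "table_flow n M i j = (if i < j \<and> j \<le> n then M (i, j) else 0)"

lemma cells_split: "flow_cells n = prod.swap ` (SIGMA j:{1..n}. {..<j}) \<union> (\<lambda>j. (j, j)) ` {0<..<n}"
  unfolding flow_cells_def by (auto simp: image_iff)

lemma finite_cells: "finite (flow_cells n)"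
  unfolding cells_split by auto

lemma cells_row: "i < n \<Longrightarrow> {c \<in> flow_cells n. fst c = i} = Pair i ` ({i<..n} \<union> {i} \<inter> {0<..})"
  unfolding flow_cells_def by auto

lemma cells_column: "0 < j \<Longrightarrow> j \<le> n \<Longrightarrow>
    {c \<in> flow_cells n. snd c = j} = (\<lambda>i. (i, j)) ` ({..<j} \<union> {j} \<inter> {..<n})"
  unfolding flow_cells_def by auto

lemma rows_cells:
  assumes "n \<ge> 1"
  shows "fst ` flow_cells n = {..<n}"
proof
  show "{..<n} \<subseteq> fst ` flow_cells n"
  proof
    fix i assume "i \<in> {..<n}"
    then have "(i, n) \<in> flow_cells n" unfolding flow_cells_def by auto
    then show "i \<in> fst ` flow_cells n" by force
  qed
qed (auto simp: flow_cells_def)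

lemma columns_cells: "snd ` flow_cells n = {1..n}"
proof
  show "{1..n} \<subseteq> snd ` flow_cells n"
  proof
    fix j assume "j \<in> {1..n}"
    then have "(0, j) \<in> flow_cells n" unfolding flow_cells_def by auto
    then show "j \<in> snd ` flow_cells n" by force
  qed
qed (auto simp: flow_cells_def)

lemma sum_cells_row:
  assumes "i < n"
  shows "(\<Sum>c\<in>{c \<in> flow_cells n. fst c = i}. M c) =
    (\<Sum>j\<in>{i<..n}. M (i, j)) + (if 0 < i then M (i, i) else 0 :: real)"
proof -
  have "(\<Sum>c\<in>{c \<in> flow_cells n. fst c = i}. M c) = (\<Sum>j\<in>{i<..n} \<union> {i} \<inter> {0<..}. M (i, j))"
    unfolding cells_row[OF assms] by (subst sum.reindex) (auto simp: inj_on_def)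
  also have "\<dots> = (\<Sum>j\<in>{i<..n}. M (i, j)) + (\<Sum>j\<in>{i} \<inter> {0<..}. M (i, j))"
    by (intro sum.union_disjoint) auto
  finally show ?thesis by (cases "0 < i") auto
qed

lemma sum_cells_column:
  assumes "0 < j" "j \<le> n"
  shows "(\<Sum>c\<in>{c \<in> flow_cells n. snd c = j}. M c) =
    (\<Sum>i<j. M (i, j)) + (if j < n then M (j, j) else 0 :: real)"
proof -
  have "(\<Sum>c\<in>{c \<in> flow_cells n. snd c = j}. M c) = (\<Sum>i\<in>{..<j} \<union> {j} \<inter> {..<n}. M (i, j))"
    unfolding cells_column[OF assms] by (subst sum.reindex) (auto simp: inj_on_def)
  also have "\<dots> = (\<Sum>i<j. M (i, j)) + (\<Sum>i\<in>{j} \<inter> {..<n}. M (i, j))"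
    by (intro sum.union_disjoint) auto
  finally show ?thesis by (cases "j < n") auto
qed

lemma flow_entropy_eq: "flow_entropy n N f = (\<Sum>c\<in>flow_cells n. hfun (flow_table N f c))"
proof -
  have "(\<Sum>c\<in>flow_cells n. hfun (flow_table N f c)) =
      (\<Sum>c\<in>prod.swap ` (SIGMA j:{1..n}. {..<j}). hfun (flow_table N f c))
      + (\<Sum>c\<in>(\<lambda>j. (j, j)) ` {0<..<n}. hfun (flow_table N f c))"
    unfolding cells_split by (intro sum.union_disjoint) auto
  also have "(\<Sum>c\<in>prod.swap ` (SIGMA j:{1..n}. {..<j}). hfun (flow_table N f c)) =
      (\<Sum>(j, i)\<in>(SIGMA j:{1..n}. {..<j}). hfun (f i j))"
    by (subst sum.reindex) (auto simp: flow_table_def intro!: sum.cong)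
  also have "\<dots> = (\<Sum>j\<in>{1..n}. \<Sum>i<j. hfun (f i j))"
    by (subst sum.Sigma) auto
  also have "(\<Sum>c\<in>(\<lambda>j. (j, j)) ` {0<..<n}. hfun (flow_table N f c)) =
      (\<Sum>j\<in>{0<..<n}. hfun (\<Sum>i<j. (real_of_int (N i) - f i j)))"
    by (subst sum.reindex) (auto simp: flow_table_def inj_on_def)
  finally show ?thesis unfolding flow_entropy_def by simp
qed

section \<open>Cuts of a flow and the margins of its table\<close>

lemma flow_netflow:
  assumes "f \<in> flows n N" "i \<le> n"
  shows "(\<Sum>j\<in>{i<..n}. f i j) - (\<Sum>k<i. f k i) = real_of_int (N i)"
  using assms unfolding flows_def by blast

lemma flow_nonneg:
  assumes "f \<in> flows n N"
  shows "f i j \<ge> 0"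
proof (cases "i < j \<and> j \<le> n")
  case True
  then show ?thesis using assms unfolding flows_def by blast
next
  case False
  then have "f i j = 0" using assms unfolding flows_def by blast
  then show ?thesis by simp
qed

text \<open>Moving vertex \<open>j\<close> across the cut trades its inflow for its outflow.
  \<open>j = n + 1\<close> gives the vanishing total, smaller \<open>j\<close> the nonnegative
  prefix sums.\<close>

lemma flow_across_cut:
  assumes f: "f \<in> flows n N" and "j \<le> Suc n"
  shows "(\<Sum>i<j. real_of_int (N i)) = (\<Sum>i<j. \<Sum>k\<in>{j..n}. f i k)"
  using \<open>j \<le> Suc n\<close>
proof (induction j)
  case (Suc j)
  have j: "j \<le> n" using Suc by simp
  have "(\<Sum>k\<in>{j..n}. f i k) = f i j + (\<Sum>k\<in>{Suc j..n}. f i k)" for i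
    using j by (simp add: sum.atLeast_Suc_atMost)
  then have "(\<Sum>i<j. \<Sum>k\<in>{j..n}. f i k) = (\<Sum>i<j. f i j) + (\<Sum>i<j. \<Sum>k\<in>{Suc j..n}. f i k)"
    by (simp add: sum.distrib)
  moreover have "{j<..n} = {Suc j..n}" by auto
  ultimately show ?case using flow_netflow[OF f j] Suc by simp
qed simp

lemma flow_total:
  assumes "f \<in> flows n N"
  shows "(\<Sum>i\<le>n. N i) = 0"
proof -
  have "real_of_int (\<Sum>i\<le>n. N i) = 0"
    using flow_across_cut[OF assms, of "Suc n"] by (simp add: lessThan_Suc_atMost)
  then show ?thesis by (simp only: of_int_eq_0_iff)
qed

lemma prefix_sum_nonneg:
  assumes "f \<in> flows n N" "k < n"
  shows "(\<Sum>i\<le>k. N i) \<ge> 0"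
proof -
  have "real_of_int (\<Sum>i\<le>k. N i) = (\<Sum>i<Suc k. \<Sum>j\<in>{Suc k..n}. f i j)"
    using flow_across_cut[OF assms(1), of "Suc k"] assms(2) by (simp add: lessThan_Suc_atMost)
  also have "\<dots> \<ge> 0" using flow_nonneg[OF assms(1)] by (intro sum_nonneg) auto
  finally show ?thesis by (simp only: of_int_0_le_iff)
qed

text \<open>The defining sum may have terms of either sign. Taking the inflow of \<open>j\<close>
  from the flow across the cut before \<open>j\<close> leaves the edges that jump over
  \<open>j\<close>, which shows nonnegativity.\<close>

lemma flow_table_diagonal:
  assumes f: "f \<in> flows n N" and j: "j \<le> n"
  shows "flow_table N f (j, j) = (\<Sum>i<j. \<Sum>k\<in>{Suc j..n}. f i k)"
proof -
  have "(\<Sum>k\<in>{j..n}. f i k) = f i j + (\<Sum>k\<in>{Suc j..n}. f i k)" for i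
    using j by (simp add: sum.atLeast_Suc_atMost)
  then show ?thesis
    using flow_across_cut[OF f, of j] j by (simp add: flow_table_def sum_subtractf sum.distrib)
qed

lemma flow_table_nonneg:
  assumes f: "f \<in> flows n N" and c: "c \<in> flow_cells n"
  shows "flow_table N f c \<ge> 0"
proof -
  obtain i j where c': "c = (i, j)" by (cases c)
  show ?thesis
  proof (cases "i < j")
    case True
    then show ?thesis using flow_nonneg[OF f] unfolding c' flow_table_def by simp
  next
    case False
    then have "i = j" "j \<le> n" using c unfolding c' flow_cells_def by auto
    then show ?thesis
      using flow_table_diagonal[OF f] flow_nonneg[OF f] unfolding c' by (auto intro!: sum_nonneg)
  qed
qed

text \<open>The flow out of \<open>i\<close> and the flow over \<open>i\<close> together cross the
  cut after \<open>i\<close>.\<close>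

lemma flow_table_row:
  assumes f: "f \<in> flows n N" and i: "i < n"
  shows "(\<Sum>c\<in>{c \<in> flow_cells n. fst c = i}. flow_table N f c) = real_of_int (\<Sum>k\<le>i. N k)"
proof -
  have "(\<Sum>c\<in>{c \<in> flow_cells n. fst c = i}. flow_table N f c) =
      (\<Sum>j\<in>{i<..n}. f i j) + (\<Sum>k<i. real_of_int (N k) - f k i)"
    unfolding sum_cells_row[OF i] by (auto simp: flow_table_def)
  also have "\<dots> = real_of_int (N i) + (\<Sum>k<i. real_of_int (N k))"
    using flow_netflow[OF f, of i] i by (simp add: sum_subtractf)
  also have "\<dots> = real_of_int (\<Sum>k\<le>i. N k)" by (simp flip: lessThan_Suc_atMost)
  finally show ?thesis .
qed

text \<open>The flow into \<open>j\<close> and the flow over \<open>j\<close> together cross the cut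
  before \<open>j\<close>, hence the index \<open>j - 1\<close>.\<close>

lemma flow_table_column:
  assumes f: "f \<in> flows n N" and j: "0 < j" "j \<le> n"
  shows "(\<Sum>c\<in>{c \<in> flow_cells n. snd c = j}. flow_table N f c) = real_of_int (\<Sum>k\<le>j - 1. N k)"
proof -
  have "flow_table N f (j, j) = 0" if "\<not> j < n"
    using flow_table_diagonal[OF f, of j] j that by simp
  then have "(\<Sum>c\<in>{c \<in> flow_cells n. snd c = j}. flow_table N f c) =
      (\<Sum>i<j. f i j) + flow_table N f (j, j)"
    unfolding sum_cells_column[OF j] by (auto simp: flow_table_def)
  also have "\<dots> = (\<Sum>k<j. real_of_int (N k))" by (simp add: flow_table_def sum_subtractf)
  also have "{..<j} = {..j - 1}" using j by auto
  finally show ?thesis by simp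
qed

lemma table_flow_table:
  assumes "f \<in> flows n N"
  shows "table_flow n (flow_table N f) = f"
proof (intro ext)
  fix i j
  have "f i j = 0" if "\<not> (i < j \<and> j \<le> n)" using assms that unfolding flows_def by blast
  then show "table_flow n (flow_table N f) i j = f i j"
    unfolding table_flow_def flow_table_def by auto
qed

text \<open>Subtract column \<open>i\<close> from row \<open>i\<close>: the diagonal entry cancels,
  leaving a difference of consecutive prefix sums. Vertex \<open>n\<close> has no row; there the
  vanishing total is used.\<close>

lemma
  assumes n: "n \<ge> 1" and total: "(\<Sum>i\<le>n. N i) = 0" and M: "\<And>c. c \<in> flow_cells n \<Longrightarrow> M c \<ge> 0"
    and rows: "\<And>i. i < n \<Longrightarrow> (\<Sum>c\<in>{c \<in> flow_cells n. fst c = i}. M c) = real_of_int (\<Sum>k\<le>i. N k)"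
    and cols: "\<And>j. 0 < j \<Longrightarrow> j \<le> n \<Longrightarrow>
      (\<Sum>c\<in>{c \<in> flow_cells n. snd c = j}. M c) = real_of_int (\<Sum>k\<le>j - 1. N k)"
  shows table_flow_in_flows: "table_flow n M \<in> flows n N"
    and flow_table_table_flow: "c \<in> flow_cells n \<Longrightarrow> flow_table N (table_flow n M) c = M c"
proof -
  define d where "d = (\<lambda>j. if 0 < j \<and> j < n then M (j, j) else 0)"
  have out: "(\<Sum>j\<in>{i<..n}. M (i, j)) = real_of_int (\<Sum>k\<le>i. N k) - d i" if "i < n" for i
    using sum_cells_row[OF that, of M] rows[OF that] that unfolding d_def by auto
  have inn: "(\<Sum>i<j. M (i, j)) = real_of_int (\<Sum>k\<le>j - 1. N k) - d j" if "0 < j" "j \<le> n" for j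
    using sum_cells_column[OF that, of M] cols[OF that] that unfolding d_def by auto
  have tout: "(\<Sum>j\<in>{i<..n}. table_flow n M i j) = (\<Sum>j\<in>{i<..n}. M (i, j))" for i
    by (intro sum.cong) (auto simp: table_flow_def)
  have tin: "(\<Sum>k<i. table_flow n M k i) = (\<Sum>k<i. M (k, i))" if "i \<le> n" for i
    using that by (intro sum.cong) (auto simp: table_flow_def)
  have "(\<Sum>j\<in>{i<..n}. table_flow n M i j) - (\<Sum>k<i. table_flow n M k i) = real_of_int (N i)"
    if i: "i \<le> n" for i
  proof -
    have split: "(\<Sum>k\<le>i. N k) = (\<Sum>k\<le>i - 1. N k) + N i" if "0 < i"
      using that by (cases i) auto
    consider "i = 0" | "0 < i" "i < n" | "0 < i" "i = n" using i n by linarith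
    then show ?thesis
    proof cases
      case 1
      then show ?thesis using out[of 0] n unfolding tout tin[OF i] by (simp add: d_def)
    next
      case 2
      then show ?thesis using out[of i] inn[of i] split unfolding tout tin[OF i] by simp
    next
      case 3
      then have "(\<Sum>k\<le>i - 1. N k) = - N i" using split total by simp
      then have "real_of_int (\<Sum>k\<le>i - 1. N k) = - real_of_int (N i)" by simp
      then show ?thesis using inn[of i] 3 unfolding tout tin[OF i] d_def by simp
    qed
  qed
  moreover have "table_flow n M i j \<ge> 0" if "i < j" "j \<le> n" for i j
    using M[of "(i, j)"] that unfolding table_flow_def flow_cells_def by auto
  ultimately show "table_flow n M \<in> flows n N"
    unfolding flows_def by (auto simp: table_flow_def)
  show "flow_table N (table_flow n M) c = M c" if c: "c \<in> flow_cells n" for c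
  proof -
    obtain i j where c': "c = (i, j)" by (cases c)
    show ?thesis
    proof (cases "i < j")
      case True
      then show ?thesis using c unfolding c' flow_cells_def flow_table_def table_flow_def by auto
    next
      case False
      then have ij: "i = j" "0 < j" "j < n" using c unfolding c' flow_cells_def by auto
      have "{..j - 1} = {..<j}" using ij by auto
      then show ?thesis
        using inn[of j] tin[of j] ij unfolding c' flow_table_def d_def
        by (simp add: sum_subtractf)
    qed
  qed
qed

text \<open>Since \<open>N\<close> is integral, an integer flow has integral diagonal entries, and
  since a flow exists, \<open>nat\<close> truncates no margin. The tables form a finite set, so
  \<open>Kn\<close> is a genuine count and not the default \<open>0\<close> of an infinite
  set.\<close>

lemma Kn_eq_card_tables:
  assumes n: "n \<ge> 1" and f0: "f0 \<in> flows n N"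
  shows "Kn n N = card (tables (flow_cells n) (\<lambda>i. nat (\<Sum>k\<le>i. N k)) (\<lambda>j. nat (\<Sum>k\<le>j - 1. N k)) (snd ` flow_cells n))"
    (is "_ = card ?T")
proof -
  let ?G = "{f \<in> flows n N. \<forall>i j. f i j \<in> \<int>}"
  have s: "(\<Sum>k\<le>i. N k) \<ge> 0" if "i < n" for i using prefix_sum_nonneg[OF f0 that] .
  have row: "(\<Sum>c\<in>{c \<in> flow_cells n. fst c = i}. real (t c)) = real_of_int (\<Sum>k\<le>i. N k)"
    if "t \<in> ?T" "i < n" for t i
  proof -
    have "(\<Sum>c\<in>{c \<in> flow_cells n. fst c = i}. t c) = nat (\<Sum>k\<le>i. N k)"
      using that unfolding tables_def rows_cells[OF n] by blast
    then have "real (\<Sum>c\<in>{c \<in> flow_cells n. fst c = i}. t c) = real_of_int (\<Sum>k\<le>i. N k)"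
      using s[OF that(2)] by (simp only: of_nat_nat)
    then show ?thesis by simp
  qed
  have col: "(\<Sum>c\<in>{c \<in> flow_cells n. snd c = j}. real (t c)) = real_of_int (\<Sum>k\<le>j - 1. N k)"
    if "t \<in> ?T" "0 < j" "j \<le> n" for t j
  proof -
    have "j \<in> {1..n}" using that by simp
    then have "(\<Sum>c\<in>{c \<in> flow_cells n. snd c = j}. t c) = nat (\<Sum>k\<le>j - 1. N k)"
      using that(1) unfolding tables_def columns_cells by blast
    then have "real (\<Sum>c\<in>{c \<in> flow_cells n. snd c = j}. t c) = real_of_int (\<Sum>k\<le>j - 1. N k)"
      using s[of "j - 1"] that by (simp only: of_nat_nat)
    then show ?thesis by simp
  qed
  have "bij_betw (\<lambda>t. table_flow n (\<lambda>c. real (t c))) ?T ?G"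
  proof (rule bij_betw_byWitness[where f' = "\<lambda>f c. if c \<in> flow_cells n then nat \<lfloor>flow_table N f c\<rfloor> else 0"])
    show "\<forall>t\<in>?T. (\<lambda>c. if c \<in> flow_cells n then nat \<lfloor>flow_table N (table_flow n (\<lambda>c. real (t c))) c\<rfloor> else 0) = t"
    proof (intro ballI ext)
      fix t c assume t: "t \<in> ?T"
      have "flow_table N (table_flow n (\<lambda>c. real (t c))) c = real (t c)" if "c \<in> flow_cells n"
        by (rule flow_table_table_flow[OF n flow_total[OF f0] _ row[OF t] col[OF t] that]) simp_all
      moreover have "t c = 0" if "c \<notin> flow_cells n" using t that unfolding tables_def by blast
      ultimately show "(if c \<in> flow_cells n then nat \<lfloor>flow_table N (table_flow n (\<lambda>c. real (t c))) c\<rfloor> else 0) = t c"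
        by auto
    qed
    have real_nat: "real (nat \<lfloor>flow_table N f c\<rfloor>) = flow_table N f c" if "f \<in> ?G" "c \<in> flow_cells n" for f c
    proof -
      have "flow_table N f c \<in> \<int>"
        using that(1) unfolding flow_table_def by (auto intro!: Ints_sum Ints_diff)
      moreover have "flow_table N f c \<ge> 0" using flow_table_nonneg that by blast
      ultimately show ?thesis by (auto elim!: Ints_cases)
    qed
    show "\<forall>f\<in>?G. table_flow n (\<lambda>c. real (if c \<in> flow_cells n then nat \<lfloor>flow_table N f c\<rfloor> else 0)) = f"
    proof
      fix f assume f: "f \<in> ?G"
      have "table_flow n (\<lambda>c. real (if c \<in> flow_cells n then nat \<lfloor>flow_table N f c\<rfloor> else 0))
          = table_flow n (flow_table N f)"
        using real_nat[OF f] unfolding table_flow_def by (auto simp: fun_eq_iff flow_cells_def)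
      then show "table_flow n (\<lambda>c. real (if c \<in> flow_cells n then nat \<lfloor>flow_table N f c\<rfloor> else 0)) = f"
        using table_flow_table f by simp
    qed
    show "(\<lambda>t. table_flow n (\<lambda>c. real (t c))) ` ?T \<subseteq> ?G"
    proof
      fix f assume "f \<in> (\<lambda>t. table_flow n (\<lambda>c. real (t c))) ` ?T"
      then obtain t where t: "t \<in> ?T" and f: "f = table_flow n (\<lambda>c. real (t c))" by blast
      have "f \<in> flows n N"
        unfolding f by (rule table_flow_in_flows[OF n flow_total[OF f0] _ row[OF t] col[OF t]]) simp_all
      then show "f \<in> ?G" unfolding f table_flow_def by auto
    qed
    show "(\<lambda>f c. if c \<in> flow_cells n then nat \<lfloor>flow_table N f c\<rfloor> else 0) ` ?G \<subseteq> ?T"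
    proof
      fix t assume "t \<in> (\<lambda>f c. if c \<in> flow_cells n then nat \<lfloor>flow_table N f c\<rfloor> else 0) ` ?G"
      then obtain f where f: "f \<in> ?G"
        and t: "t = (\<lambda>c. if c \<in> flow_cells n then nat \<lfloor>flow_table N f c\<rfloor> else 0)" by blast
      have f': "f \<in> flows n N" using f by blast
      have real_t: "real (\<Sum>c\<in>A. t c) = (\<Sum>c\<in>A. flow_table N f c)" if "A \<subseteq> flow_cells n" for A
        using real_nat[OF f] that unfolding t of_nat_sum by (intro sum.cong) auto
      have r: "(\<Sum>c\<in>{c \<in> flow_cells n. fst c = i}. t c) = nat (\<Sum>k\<le>i. N k)" if "i < n" for i
      proof -
        have "real (\<Sum>c\<in>{c \<in> flow_cells n. fst c = i}. t c) = real_of_int (\<Sum>k\<le>i. N k)"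
          using real_t[of "{c \<in> flow_cells n. fst c = i}"] flow_table_row[OF f' that] by auto
        then show ?thesis by linarith
      qed
      have c: "(\<Sum>c\<in>{c \<in> flow_cells n. snd c = j}. t c) = nat (\<Sum>k\<le>j - 1. N k)" if "0 < j" "j \<le> n" for j
      proof -
        have "real (\<Sum>c\<in>{c \<in> flow_cells n. snd c = j}. t c) = real_of_int (\<Sum>k\<le>j - 1. N k)"
          using real_t[of "{c \<in> flow_cells n. snd c = j}"] flow_table_column[OF f' that] by auto
        then show ?thesis by linarith
      qed
      have "t c = 0" if "c \<notin> flow_cells n" for c using that unfolding t by simp
      then show "t \<in> ?T"
        unfolding tables_def rows_cells[OF n] columns_cells using r c by auto
    qed
  qed
  then show ?thesis unfolding Kn_def by (simp add: bij_betw_same_card)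
qed

text \<open>Makes the supremum a real one: \<open>hfun\<close> grows at most linearly by
  \<open>hfun_le\<close> at \<open>z = 1 / 2\<close>, and the table entries have a fixed
  sum.\<close>

lemma flow_entropy_bounded:
  assumes n: "n \<ge> 1" and f: "f \<in> flows n N"
  shows "flow_entropy n N f \<le>
    ((\<Sum>i<n. real_of_int (\<Sum>k\<le>i. N k)) + real (card (flow_cells n))) * ln 2"
proof -
  have h: "hfun m \<le> (m + 1) * ln 2" if "m \<ge> 0" for m
    using hfun_le[OF that, of "1 / 2"] by (simp add: ln_div algebra_simps)
  have "flow_entropy n N f \<le> (\<Sum>c\<in>flow_cells n. (flow_table N f c + 1) * ln 2)"
    unfolding flow_entropy_eq using flow_table_nonneg[OF f] by (intro sum_mono h)
  also have "\<dots> = ((\<Sum>c\<in>flow_cells n. flow_table N f c) + real (card (flow_cells n))) * ln 2"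
    by (simp add: sum_distrib_right[symmetric] sum.distrib)
  also have "(\<Sum>c\<in>flow_cells n. flow_table N f c) = (\<Sum>i<n. real_of_int (\<Sum>k\<le>i. N k))"
    unfolding sum_by_rows[OF finite_cells] rows_cells[OF n] using flow_table_row[OF f] by simp
  finally show ?thesis .
qed

text \<open>The witness is the average of all integer flows, taken in table form; margins are
  linear, so the average keeps them.\<close>

lemma Kn_le_exp_flow_entropy:
  assumes n: "n \<ge> 1" and f0: "f0 \<in> flows n N" and K: "Kn n N > 0"
  shows "\<exists>f\<in>flows n N. real (Kn n N) \<le> exp (flow_entropy n N f)"
proof -
  let ?J = "snd ` flow_cells n"
  let ?a = "\<lambda>i. nat (\<Sum>k\<le>i. N k)" and ?b = "\<lambda>j. nat (\<Sum>k\<le>j - 1. N k)"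
  define T where "T = tables (flow_cells n) ?a ?b ?J"
  define M where "M = (\<lambda>c. (\<Sum>t\<in>T. real (t c)) / real (card T))"
  have card_T: "Kn n N = card T" unfolding T_def by (rule Kn_eq_card_tables[OF n f0])
  \<comment> \<open>A positive cardinality excludes the infinite set as well as the empty
    one.\<close>
  then have T: "finite T" "T \<noteq> {}" and cT: "real (card T) > 0"
    using K card_gt_0_iff[of T] by auto
  have s: "(\<Sum>k\<le>i. N k) \<ge> 0" if "i < n" for i using prefix_sum_nonneg[OF f0 that] .
  have mean: "(\<Sum>c\<in>A. M c) = x" if "\<And>t. t \<in> T \<Longrightarrow> (\<Sum>c\<in>A. t c) = nat k" "k \<ge> 0" "x = real_of_int k" for A k x
  proof -
    have "(\<Sum>c\<in>A. real (t c)) = x" if "t \<in> T" for t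
    proof -
      have "real (\<Sum>c\<in>A. t c) = x"
        using \<open>\<And>t. t \<in> T \<Longrightarrow> (\<Sum>c\<in>A. t c) = nat k\<close>[OF that] \<open>k \<ge> 0\<close> \<open>x = real_of_int k\<close>
        by (simp only: of_nat_nat)
      then show ?thesis by simp
    qed
    then have "(\<Sum>t\<in>T. \<Sum>c\<in>A. real (t c)) = real (card T) * x" by simp
    moreover have "(\<Sum>c\<in>A. M c) = (\<Sum>t\<in>T. \<Sum>c\<in>A. real (t c)) / real (card T)"
      unfolding M_def sum_divide_distrib[symmetric] by (subst sum.swap) (rule refl)
    ultimately show ?thesis using cT by simp
  qed
  have rows: "(\<Sum>c\<in>{c \<in> flow_cells n. fst c = i}. M c) = real_of_int (\<Sum>k\<le>i. N k)" if "i < n" for i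
  proof (rule mean[OF _ s[OF that] refl])
    fix t assume "t \<in> T"
    then show "(\<Sum>c\<in>{c \<in> flow_cells n. fst c = i}. t c) = ?a i"
      using that unfolding T_def tables_def rows_cells[OF n] by blast
  qed
  have cols: "(\<Sum>c\<in>{c \<in> flow_cells n. snd c = j}. M c) = real_of_int (\<Sum>k\<le>j - 1. N k)"
    if j: "0 < j" "j \<le> n" for j
  proof (rule mean[OF _ s refl])
    show "j - 1 < n" using j by simp
    have "j \<in> {1..n}" using j by simp
    then show "(\<Sum>c\<in>{c \<in> flow_cells n. snd c = j}. t c) = ?b j" if "t \<in> T" for t
      using that unfolding T_def tables_def columns_cells by blast
  qed
  have M: "M c \<ge> 0" for c unfolding M_def by (simp add: sum_nonneg)
  have "real (card T) \<le> exp (\<Sum>c\<in>flow_cells n. hfun (M c))"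
    unfolding M_def using T by (intro card_le_exp_entropy finite_cells) (auto simp: T_def tables_def)
  also have "(\<Sum>c\<in>flow_cells n. hfun (M c)) = flow_entropy n N (table_flow n M)"
    unfolding flow_entropy_eq
    using flow_table_table_flow[OF n flow_total[OF f0] M rows cols] by (intro sum.cong) auto
  finally show ?thesis
    unfolding card_T using table_flow_in_flows[OF n flow_total[OF f0] M rows cols] by blast
qed

text \<open>Column \<open>Suc k0\<close>, of margin \<open>s k0\<close>, is the one left free, so
  the product over columns lacks exactly this factor.\<close>

lemma exp_flow_entropy_le_Kn:
  assumes n: "n \<ge> 1" and f: "f \<in> flows n N" and k0: "k0 < n"
    and s: "\<And>k. s k = real_of_int (\<Sum>j\<le>k. N j)"
  shows "exp (hfun (s k0)) / (\<Prod>k<n. exp (hfun (s k)))\<^sup>2 * exp (flow_entropy n N f) \<le> real (Kn n N)"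
proof -
  let ?J = "snd ` flow_cells n"
  let ?a = "\<lambda>i. nat (\<Sum>k\<le>i. N k)" and ?b = "\<lambda>j. nat (\<Sum>k\<le>j - 1. N k)"
  let ?P = "\<Prod>k<n. exp (hfun (s k))"
  have sa: "real (?a i) = s i" if "i < n" for i
    unfolding s using prefix_sum_nonneg[OF f that] by (simp only: of_nat_nat)
  have "exp (\<Sum>c\<in>flow_cells n. hfun (flow_table N f c)) * (\<Prod>i\<in>fst ` flow_cells n. exp (- hfun (real (?a i))))
      * (\<Prod>j\<in>?J - {Suc k0}. exp (- hfun (real (?b j)))) \<le> real (card (tables (flow_cells n) ?a ?b ?J))"
  proof (rule card_tables_lower_bound[OF finite_cells])
    show "Suc k0 \<in> ?J" unfolding columns_cells using k0 by simp
    show "flow_table N f c \<ge> 0" if "c \<in> flow_cells n" for c using flow_table_nonneg[OF f that] .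
    show "(\<Sum>c\<in>{c \<in> flow_cells n. fst c = i}. flow_table N f c) = real (?a i)" if "i \<in> fst ` flow_cells n" for i
      using that flow_table_row[OF f, of i] sa[of i] unfolding rows_cells[OF n] s by simp
    show "(\<Sum>c\<in>{c \<in> flow_cells n. snd c = j}. flow_table N f c) = real (?b j)" if "j \<in> ?J" for j
      using that flow_table_column[OF f, of j] sa[of "j - 1"] unfolding columns_cells s by auto
  qed
  moreover have "(\<Prod>i\<in>fst ` flow_cells n. exp (- hfun (real (?a i)))) = 1 / ?P"
    unfolding rows_cells[OF n] using sa by (simp add: exp_minus inverse_eq_divide prod_dividef)
  moreover have "(\<Prod>j\<in>?J - {Suc k0}. exp (- hfun (real (?b j)))) = exp (hfun (s k0)) / ?P"
  proof -
    have "1 / ?P = (\<Prod>k<n. exp (- hfun (s k)))"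
      by (simp add: exp_minus inverse_eq_divide prod_dividef)
    also have "\<dots> = (\<Prod>j\<in>?J. exp (- hfun (real (?b j))))"
      unfolding columns_cells
      by (rule prod.reindex_bij_witness[where i = "\<lambda>j. j - 1" and j = Suc]) (auto simp: sa)
    also have "\<dots> = exp (- hfun (s k0)) * (\<Prod>j\<in>?J - {Suc k0}. exp (- hfun (real (?b j))))"
      using k0 sa[OF k0] unfolding columns_cells by (subst prod.remove[of _ "Suc k0"]) auto
    finally show ?thesis by (simp add: exp_minus field_simps)
  qed
  ultimately show ?thesis
    unfolding Kn_eq_card_tables[OF n f] flow_entropy_eq by (simp add: power2_eq_square mult_ac)
qed

theorem theorem1p5:
  fixes n :: nat and N :: "nat \<Rightarrow> int" and s :: "nat \<Rightarrow> real"
  assumes "n \<ge> 1"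
    and "flows n N \<noteq> {}"
    and "\<And>k. s k = real_of_int (\<Sum>j\<le>k. N j)"
  shows "(SUP f\<in>flows n N. exp (flow_entropy n N f)) \<ge> real (Kn n N)
    \<and> real (Kn n N) \<ge>
           Max ((\<lambda>k. exp (hfun (s k))) ` {0..n-1})
             / (\<Prod>k<n. exp (hfun (s k)))^2
             * (SUP f\<in>flows n N. exp (flow_entropy n N f))"
proof
  let ?S = "SUP f\<in>flows n N. exp (flow_entropy n N f)"
  obtain f0 where f0: "f0 \<in> flows n N" using assms(2) by blast
  have bdd: "bdd_above ((\<lambda>f. exp (flow_entropy n N f)) ` flows n N)"
    using flow_entropy_bounded[OF assms(1)]
    by (intro bdd_aboveI2[where M = "exp (((\<Sum>i<n. real_of_int (\<Sum>k\<le>i. N k)) + real (card (flow_cells n))) * ln 2)"])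
      (simp only: exp_le_cancel_iff)
  have upper: "exp (flow_entropy n N f) \<le> ?S" if "f \<in> flows n N" for f
    using that bdd by (rule cSUP_upper)
  show "?S \<ge> real (Kn n N)"
  proof (cases "Kn n N > 0")
    case True
    then show ?thesis using Kn_le_exp_flow_entropy[OF assms(1) f0] upper by (meson order_trans)
  next
    case False
    then show ?thesis using order_trans[OF exp_ge_zero upper[OF f0]] by simp
  qed
  let ?P = "\<Prod>k<n. exp (hfun (s k))"
  have "Max ((\<lambda>k. exp (hfun (s k))) ` {0..n-1}) \<in> (\<lambda>k. exp (hfun (s k))) ` {0..n-1}"
    by (intro Max_in) auto
  then obtain k0 where k0: "k0 \<in> {0..n-1}"
    and max: "Max ((\<lambda>k. exp (hfun (s k))) ` {0..n-1}) = exp (hfun (s k0))" by (rule imageE) blast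
  have k0n: "k0 < n" using k0 assms(1) by auto
  have P: "?P > 0" by (intro prod_pos) simp
  \<comment> \<open>Solved for the entropy, the bound has a right side that does not depend on the
    flow, so it passes to the supremum.\<close>
  have "?S \<le> real (Kn n N) * ?P\<^sup>2 / exp (hfun (s k0))"
  proof (rule cSUP_least[OF assms(2)])
    fix f assume "f \<in> flows n N"
    from exp_flow_entropy_le_Kn[OF assms(1) this k0n assms(3)]
    show "exp (flow_entropy n N f) \<le> real (Kn n N) * ?P\<^sup>2 / exp (hfun (s k0))"
      using P by (simp add: field_simps)
  qed
  then show "real (Kn n N) \<ge> Max ((\<lambda>k. exp (hfun (s k))) ` {0..n-1}) / ?P\<^sup>2 * ?S"
    unfolding max using P by (simp add: field_simps)
qed

end
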